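(* Fix $\alpha,\beta>0$. For $n\ge3$ let $S$ be a random $\alpha/\beta$-staircase tableau of size $n$ with law $\mathbb{P}_{n,\alpha,\beta}$, and let $A_n^{(3)}$ be the number of boxes $(n-j-1,j)$, $1\le j\le n-2$ (the third main diagonal), that contain $\alpha$. Then, as $n\to\infty$, $A_n^{(3)}$ converges in distribution to a Poisson random variable with parameter $1/2$.
   Context: A staircase tableau of size $n$ has boxes $(i,j)$ with $i,j\ge1$ and $i+j\le n+1$, rows numbered from the top and columns from the left. An $\alpha/\beta$-staircase tableau of size $n$ is a filling in which each box is empty or contains $\alpha$ or $\beta$, such that: all boxes in the same column and above an $\alpha$ are empty; all boxes in the same row and to the left of a $\beta$ are empty; every main-diagonal box (with $i+j=n+1$) contains a symbol. $\overline{\mathcal{S}}_n$ is the set of these. The weight is $wt(S)=\alpha^{N_\alpha}\beta^{N_\beta}$ ($N_\alpha,N_\beta$ the numbers of $\alpha$'s, $\beta$'s), and $\mathbb{P}_{n,\alpha,\beta}(S)=wt(S)/\sum_{T\in\overline{\mathcal{S}}_n}wt(T)$. *)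

theory Defs
  imports "HOL-Probability.Probability"
begin

datatype sym = Alpha | Beta

text \<open>A filling of the plane; boxes are pairs (row i, column j), rows numbered from the top.\<close>
type_synonym filling = "nat \<times> nat \<Rightarrow> sym option"

definition boxes :: "nat \<Rightarrow> (nat \<times> nat) set" where
  "boxes n = {(i, j). 1 \<le> i \<and> 1 \<le> j \<and> i + j \<le> n + 1}"

definition staircase_tableaux :: "nat \<Rightarrow> filling set" where
  "staircase_tableaux n = {S.
     (\<forall>b. b \<notin> boxes n \<longrightarrow> S b = None) \<and>
     (\<forall>i j. (i, j) \<in> boxes n \<and> S (i, j) = Some Alpha \<longrightarrow>
            (\<forall>i'. 1 \<le> i' \<and> i' < i \<longrightarrow> S (i', j) = None)) \<and>
     (\<forall>i j. (i, j) \<in> boxes n \<and> S (i, j) = Some Beta \<longrightarrow>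
            (\<forall>j'. 1 \<le> j' \<and> j' < j \<longrightarrow> S (i, j') = None)) \<and>
     (\<forall>i j. 1 \<le> i \<and> 1 \<le> j \<and> i + j = n + 1 \<longrightarrow> S (i, j) \<noteq> None)}"

definition N_alpha :: "nat \<Rightarrow> filling \<Rightarrow> nat" where
  "N_alpha n S = card {b \<in> boxes n. S b = Some Alpha}"

definition N_beta :: "nat \<Rightarrow> filling \<Rightarrow> nat" where
  "N_beta n S = card {b \<in> boxes n. S b = Some Beta}"

definition wt :: "real \<Rightarrow> real \<Rightarrow> nat \<Rightarrow> filling \<Rightarrow> real" where
  "wt \<alpha> \<beta> n S = \<alpha> ^ N_alpha n S * \<beta> ^ N_beta n S"

definition tableau_law :: "real \<Rightarrow> real \<Rightarrow> nat \<Rightarrow> filling pmf" where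
  "tableau_law \<alpha> \<beta> n = embed_pmf (\<lambda>S. if S \<in> staircase_tableaux n
      then wt \<alpha> \<beta> n S / (\<Sum>T\<in>staircase_tableaux n. wt \<alpha> \<beta> n T) else 0)"

definition A3 :: "nat \<Rightarrow> filling \<Rightarrow> nat" where
  "A3 n S = card {j \<in> {1..n-2}. S (n - j - 1, j) = Some Alpha}"

end

theory Submission
  imports Defs "HOL-Real_Asymp.Real_Asymp"
begin

text \<open>
  Removing the first column of a tableau of size \<open>n + 1\<close> leaves one of size \<open>n\<close>, and the possible
  first columns depend only on the set of rows without \<open>\<beta>\<close>. Let \<open>H n x\<close> be the sum of
  \<open>wt S * t ^ A3 S * x ^ f\<close> over all tableaux \<open>S\<close> of size \<open>n\<close>, where \<open>f\<close> is the number of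
  \<open>\<beta>\<close>-free rows of \<open>S\<close>. Summing over the first columns yields an exact linear recursion for
  \<open>H (k + 3) x\<close> in terms of \<open>H (k + 2) (x + \<beta>)\<close>, \<open>H k (x + \<beta>)\<close>, \<open>H k x\<close> and \<open>H (k - 1) x\<close>.
  Divided by the value at \<open>t = 1\<close>, a product, it becomes to leading order
  \<open>g N j = g N (j + 1) + (t - 1) * j / N^2 * g (N - 2) (j + 1)\<close> with \<open>x = 1 + j \<beta>\<close> and
  \<open>N = n + j\<close>, which is solved by \<open>exp ((t - 1) * (1 - (j / N)^2) / 2)\<close>. At \<open>j = 0\<close> and
  \<open>t = exp (i \<theta>)\<close> this is the characteristic function of the Poisson law with parameter \<open>1/2\<close>,
  and Levy's continuity theorem applies.
\<close>

section \<open>Adding a first column\<close>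

text \<open>Besides the new bottom row, only these rows can receive a symbol in a new leftmost
  column, because boxes left of a \<beta> stay empty.\<close>

definition free_rows :: "nat \<Rightarrow> filling \<Rightarrow> nat set" where
  "free_rows n S = {i \<in> {1..n}. \<forall>j. S (i, j) \<noteq> Some Beta}"

text \<open>
  A new first column is encoded by a set \<^term>\<open>M\<close> of \<open>\<beta>\<close>-free rows and a bit \<^term>\<open>q\<close>:
  the bottom box and the boxes in rows \<^term>\<open>M\<close> are occupied, and the topmost occupied box
  carries \<open>\<alpha>\<close> precisely if \<^term>\<open>q\<close> holds. Every column arises exactly once because an
  \<open>\<alpha>\<close> must have empty boxes above it.
\<close>
definition add_column :: "nat \<Rightarrow> filling \<Rightarrow> bool \<Rightarrow> nat set \<Rightarrow> filling" where
  "add_column n S q M = (\<lambda>(i, j).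
     if j = 0 then None
     else if j = 1 then
       (if i \<in> insert (Suc n) M
        then Some (if q \<and> i = Min (insert (Suc n) M) then Alpha else Beta) else None)
     else S (i, j - 1))"

text \<open>Column 0 is cleared explicitly: a plain shift would move the deleted first column
  there.\<close>

definition del_column :: "filling \<Rightarrow> filling" where
  "del_column S = (\<lambda>(i, j). if j = 0 then None else S (i, Suc j))"

lemma finite_free_rows [simp]: "finite (free_rows n S)"
  by (simp add: free_rows_def)

lemma free_rows_subset: "free_rows n S \<subseteq> {1..n}"
  by (auto simp: free_rows_def)

section \<open>Finiteness and the defining conditions of tableaux\<close>

lemma finite_boxes: "finite (boxes n)"
proof -
  have "boxes n \<subseteq> {..n+1} \<times> {..n+1}"
    by (auto simp: boxes_def)
  then show ?thesis
    by (rule finite_subset) simp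
qed

lemma finite_staircase_tableaux: "finite (staircase_tableaux n)"
proof -
  have "finite (UNIV :: sym option set)"
  proof -
    have "(UNIV :: sym option set) = {None, Some Alpha, Some Beta}"
      by (auto, metis not_None_eq sym.exhaust)
    then show ?thesis by (metis finite.simps)
  qed
  then have "finite {S :: filling. \<forall>b. (b \<in> boxes n \<longrightarrow> S b \<in> UNIV) \<and> (b \<notin> boxes n \<longrightarrow> S b = None)}"
    by (rule finite_set_of_finite_funs[OF finite_boxes])
  then show ?thesis
    by (rule rev_finite_subset) (auto simp: staircase_tableaux_def)
qed

lemma tableau_outside:
  "S \<in> staircase_tableaux n \<Longrightarrow> i = 0 \<or> j = 0 \<or> i + j > Suc n \<Longrightarrow> S (i, j) = None"
proof -
  assume "S \<in> staircase_tableaux n" and ij: "i = 0 \<or> j = 0 \<or> i + j > Suc n"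
  then have "\<forall>b. b \<notin> boxes n \<longrightarrow> S b = None" unfolding staircase_tableaux_def by blast
  moreover have "(i, j) \<notin> boxes n" using ij by (auto simp: boxes_def)
  ultimately show ?thesis by blast
qed

lemma tableau_above_Alpha:
  "S \<in> staircase_tableaux n \<Longrightarrow> S (i, j) = Some Alpha \<Longrightarrow> i' < i \<Longrightarrow> S (i', j) = None"
  unfolding staircase_tableaux_def mem_Collect_eq
  by (metis (no_types, lifting) Suc_leI boxes_def case_prodD mem_Collect_eq not_Some_eq
      One_nat_def gr0I case_prodI)

lemma tableau_left_of_Beta:
  "S \<in> staircase_tableaux n \<Longrightarrow> S (i, j) = Some Beta \<Longrightarrow> j' < j \<Longrightarrow> S (i, j') = None"
  unfolding staircase_tableaux_def mem_Collect_eq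
  by (metis (no_types, lifting) Suc_leI boxes_def case_prodD mem_Collect_eq not_Some_eq
      One_nat_def gr0I case_prodI)

lemma tableau_diagonal:
  "S \<in> staircase_tableaux n \<Longrightarrow> 1 \<le> i \<Longrightarrow> 1 \<le> j \<Longrightarrow> i + j = Suc n \<Longrightarrow> S (i, j) \<noteq> None"
  unfolding staircase_tableaux_def mem_Collect_eq by (metis Suc_eq_plus1)

lemma tableau_intro:
  assumes "\<And>i j. i = 0 \<or> j = 0 \<or> i + j > Suc n \<Longrightarrow> S (i, j) = None"
    and "\<And>i j i'. S (i, j) = Some Alpha \<Longrightarrow> 0 < i' \<Longrightarrow> i' < i \<Longrightarrow> S (i', j) = None"
    and "\<And>i j j'. S (i, j) = Some Beta \<Longrightarrow> 0 < j' \<Longrightarrow> j' < j \<Longrightarrow> S (i, j') = None"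
    and "\<And>i j. 1 \<le> i \<Longrightarrow> 1 \<le> j \<Longrightarrow> i + j = Suc n \<Longrightarrow> S (i, j) \<noteq> None"
  shows "S \<in> staircase_tableaux n"
  unfolding staircase_tableaux_def mem_Collect_eq
proof (intro conjI allI impI)
  fix b assume "b \<notin> boxes n"
  then show "S b = None"
    using assms(1) by (cases b) (auto simp: boxes_def)
next
  fix i j i' assume "(i, j) \<in> boxes n \<and> S (i, j) = Some Alpha" "1 \<le> i' \<and> i' < i"
  then show "S (i', j) = None" using assms(2)[of i j i'] by simp
next
  fix i j j' assume "(i, j) \<in> boxes n \<and> S (i, j) = Some Beta" "1 \<le> j' \<and> j' < j"
  then show "S (i, j') = None" using assms(3)[of i j j'] by simp
next
  fix i j assume "1 \<le> i \<and> 1 \<le> j \<and> i + j = n + 1"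
  then show "S (i, j) \<noteq> None" using assms(4)[of i j] by simp
qed

section \<open>Effect of a new first column on a tableau and its statistics\<close>

context
  fixes n :: nat and S :: filling and q :: bool and M :: "nat set"
  assumes S: "S \<in> staircase_tableaux n" and M: "M \<subseteq> free_rows n S"
begin

private lemma M_range: "i \<in> M \<Longrightarrow> 1 \<le> i \<and> i \<le> n"
  using M by (auto simp: free_rows_def)

private lemma finite_M: "finite M"
  using M finite_free_rows finite_subset by blast

private lemma Min_in: "Min (insert (Suc n) M) \<in> insert (Suc n) M"
  using finite_M by (metis Min_in finite.insertI insert_not_empty)

private lemma Min_le: "i \<in> insert (Suc n) M \<Longrightarrow> Min (insert (Suc n) M) \<le> i"
  using finite_M by simp

private lemma add_column_1:
  "add_column n S q M (i, Suc 0) = (if i \<in> insert (Suc n) M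
        then Some (if q \<and> i = Min (insert (Suc n) M) then Alpha else Beta) else None)"
  by (simp add: add_column_def)

private lemma add_column_Suc:
  "j \<noteq> 0 \<Longrightarrow> add_column n S q M (i, Suc j) = S (i, j)"
  by (simp add: add_column_def)

text \<open>Marked rows contain no \<beta>, so the row condition survives; in the new column only
  the topmost symbol can be \<alpha>, so the column condition holds.\<close>

lemma add_column_tableau: "add_column n S q M \<in> staircase_tableaux (Suc n)"
proof (rule tableau_intro)
  fix i j assume "i = 0 \<or> j = 0 \<or> i + j > Suc (Suc n)"
  then show "add_column n S q M (i, j) = None"
    using M_range[of i] tableau_outside[OF S, of i "j - 1"]
    by (cases "j = 0 \<or> j = 1") (auto simp: add_column_def less_diff_conv)
next
  fix i j i' assume a: "add_column n S q M (i, j) = Some Alpha" "0 < i'" "i' < i"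
  show "add_column n S q M (i', j) = None"
  proof (cases "j = 1")
    case True
    then have "i = Min (insert (Suc n) M)"
      using a by (auto simp: add_column_1 split: if_splits)
    then have "i' \<notin> insert (Suc n) M" using Min_le[of i'] a by linarith
    then show ?thesis using True by (simp add: add_column_1)
  next
    case False
    then show ?thesis using a tableau_above_Alpha[OF S] by (auto simp: add_column_def split: if_splits)
  qed
next
  fix i j j' assume a: "add_column n S q M (i, j) = Some Beta" "0 < j'" "j' < j"
  then have "j > 1" by simp
  then have b: "S (i, j - 1) = Some Beta" using a by (auto simp: add_column_def)
  show "add_column n S q M (i, j') = None"
  proof (cases "j' = 1")
    case True
    have "i \<notin> M" using b M by (auto simp: free_rows_def)
    moreover have "i \<noteq> Suc n" using b tableau_outside[OF S, of i "j - 1"] \<open>j > 1\<close> by auto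
    ultimately show ?thesis using True by (simp add: add_column_1)
  next
    case False
    then show ?thesis using a b tableau_left_of_Beta[OF S b, of "j' - 1"]
      by (auto simp: add_column_def)
  qed
next
  fix i j :: nat assume "1 \<le> i" "1 \<le> j" "i + j = Suc (Suc n)"
  then show "add_column n S q M (i, j) \<noteq> None"
    using tableau_diagonal[OF S, of i "j - 1"] by (cases "j = 1") (auto simp: add_column_def)
qed

text \<open>A marked row acquires a \<beta> unless it carries the \<alpha>. The row of the \<alpha>
  is free, being either a formerly free row or the new bottom row.\<close>

lemma free_rows_add_column:
  "free_rows (Suc n) (add_column n S q M) =
     (free_rows n S - M) \<union> (if q then {Min (insert (Suc n) M)} else {})"
proof (intro set_eqI)
  fix i
  have new: "(\<forall>j. add_column n S q M (i, j) \<noteq> Some Beta) \<longleftrightarrow>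
      (\<forall>j. S (i, j) \<noteq> Some Beta) \<and> (i \<in> insert (Suc n) M \<longrightarrow> q \<and> i = Min (insert (Suc n) M))"
    (is "?l \<longleftrightarrow> ?r")
  proof
    assume l: ?l
    have "S (i, j) \<noteq> Some Beta" for j
      using l[rule_format, of "Suc j"] tableau_outside[OF S, of i 0]
      by (cases "j = 0") (auto simp: add_column_Suc)
    moreover have "i \<in> insert (Suc n) M \<longrightarrow> q \<and> i = Min (insert (Suc n) M)"
      using l[rule_format, of 1] by (auto simp: add_column_1 split: if_splits)
    ultimately show ?r by blast
  next
    assume r: ?r
    show ?l
    proof
      fix j
      show "add_column n S q M (i, j) \<noteq> Some Beta"
      proof (cases "j = 1")
        case True
        then show ?thesis
          using conjunct2[OF r] unfolding True One_nat_def add_column_1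
          by (metis option.distinct(1) option.inject sym.distinct(1))
      next
        case False
        then show ?thesis using conjunct1[OF r] by (simp add: add_column_def)
      qed
    qed
  qed
  have last: "\<forall>j. S (Suc n, j) \<noteq> Some Beta"
  proof
    fix j show "S (Suc n, j) \<noteq> Some Beta"
      using tableau_outside[OF S, of "Suc n" j] by (cases "j = 0") auto
  qed
  have Mfree: "\<forall>i\<in>M. \<forall>j. S (i, j) \<noteq> Some Beta" using M by (auto simp: free_rows_def)
  show "i \<in> free_rows (Suc n) (add_column n S q M) \<longleftrightarrow>
     i \<in> (free_rows n S - M) \<union> (if q then {Min (insert (Suc n) M)} else {})"
  proof (cases "i = Suc n")
    case True
    then show ?thesis
      unfolding free_rows_def mem_Collect_eq new
      using last by auto
  next
    case False
    then show ?thesis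
      unfolding free_rows_def mem_Collect_eq new
      using Min_in Mfree M_range[of i] by (cases "i = Min (insert (Suc n) M)") auto
  qed
qed

lemma N_alpha_add_column:
  "N_alpha (Suc n) (add_column n S q M) = N_alpha n S + of_bool q"
proof -
  have "{b \<in> boxes (Suc n). add_column n S q M b = Some Alpha} =
      (\<lambda>(i, j). (i, Suc j)) ` {b \<in> boxes n. S b = Some Alpha} \<union>
      (if q then {(Min (insert (Suc n) M), 1)} else {})" (is "?L = ?A \<union> ?B")
  proof (intro set_eqI iffI)
    fix b assume b: "b \<in> ?L"
    obtain i j where ij: "b = (i, j)" by fastforce
    show "b \<in> ?A \<union> ?B"
    proof (cases "j = 1")
      case True
      then show ?thesis using b ij by (auto simp: add_column_1 split: if_splits)
    next
      case False
      then have "(i, j - 1) \<in> {b \<in> boxes n. S b = Some Alpha}" "b = (i, Suc (j - 1))"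
        using b ij by (auto simp: add_column_def boxes_def)
      then show ?thesis by force
    qed
  next
    fix b assume "b \<in> ?A \<union> ?B"
    then show "b \<in> ?L"
      using Min_in M_range[of "Min (insert (Suc n) M)"]
      by (auto simp: boxes_def add_column_def split: if_splits)
  qed
  moreover have "?A \<inter> ?B = {}" by (auto simp: boxes_def)
  moreover have "finite ?A" "finite ?B" using finite_boxes by auto
  moreover have "card ?A = N_alpha n S"
    unfolding N_alpha_def by (rule card_image) (auto simp: inj_on_def)
  moreover have "card ?B = of_bool q" by auto
  ultimately show ?thesis
    unfolding N_alpha_def by (simp add: card_Un_disjoint)
qed

text \<open>The new column has \<open>card M + 1\<close> symbols, and exactly one of them is
  \<alpha> if \<open>q\<close> holds.\<close>

lemma N_beta_add_column:
  "N_beta (Suc n) (add_column n S q M) = N_beta n S + card M + of_bool (\<not> q)"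
proof -
  let ?m = "Min (insert (Suc n) M)"
  have "{b \<in> boxes (Suc n). add_column n S q M b = Some Beta} =
      (\<lambda>(i, j). (i, Suc j)) ` {b \<in> boxes n. S b = Some Beta} \<union>
      (\<lambda>i. (i, 1)) ` (insert (Suc n) M - (if q then {?m} else {}))" (is "?L = ?A \<union> ?B")
  proof (intro set_eqI iffI)
    fix b assume b: "b \<in> ?L"
    obtain i j where ij: "b = (i, j)" by fastforce
    show "b \<in> ?A \<union> ?B"
    proof (cases "j = 1")
      case True
      then show ?thesis using b ij by (auto simp: add_column_1 split: if_splits)
    next
      case False
      then have "(i, j - 1) \<in> {b \<in> boxes n. S b = Some Beta}" "b = (i, Suc (j - 1))"
        using b ij by (auto simp: add_column_def boxes_def)
      then show ?thesis by force
    qed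
  next
    fix b assume "b \<in> ?A \<union> ?B"
    then show "b \<in> ?L"
      using M_range by (fastforce simp: boxes_def add_column_def split: if_splits)
  qed
  moreover have "?A \<inter> ?B = {}" by (auto simp: boxes_def)
  moreover have "finite ?A" "finite ?B" using finite_boxes finite_M by auto
  moreover have "card ?A = N_beta n S"
    unfolding N_beta_def by (rule card_image) (auto simp: inj_on_def)
  moreover have "card ?B = card M + of_bool (\<not> q)"
  proof -
    have "card (insert (Suc n) M) = Suc (card M)"
      using M_range finite_M by (subst card_insert_disjoint) fastforce+
    moreover have "card ?B = card (insert (Suc n) M - (if q then {?m} else {}))"
      by (rule card_image) (auto simp: inj_on_def)
    ultimately show ?thesis using Min_in finite_M by (simp add: card_Diff_singleton)
  qed
  ultimately show ?thesis
    unfolding N_beta_def by (simp add: card_Un_disjoint)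
qed

text \<open>The shift of \<open>(i, j)\<close> to \<open>(i, Suc j)\<close> carries the third
  diagonal of size \<open>n\<close> into that of size \<open>Suc n\<close>; the only box it can miss
  is \<open>(n - 1, 1)\<close>.\<close>

lemma A3_add_column:
  "A3 (Suc n) (add_column n S q M) = A3 n S + of_bool (q \<and> Min (insert (Suc n) M) = n - 1)"
proof -
  let ?m = "Min (insert (Suc n) M)"
  \<comment> \<open>Rows start at 1, so for \<open>n \<le> 1\<close> the truncated
    \<open>n - 1 = 0\<close> is never the row of the \<alpha>.\<close>
  have m: "?m \<ge> 1" using Min_in M_range by (metis insertE le_add1 plus_1_eq_Suc)
  have "{j \<in> {1..Suc n - 2}. add_column n S q M (Suc n - j - 1, j) = Some Alpha} =
      Suc ` {j \<in> {1..n - 2}. S (n - j - 1, j) = Some Alpha} \<union>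
      (if q \<and> ?m = n - 1 then {1} else {})" (is "?L = ?A \<union> ?B")
  proof (intro set_eqI iffI)
    fix j assume j: "j \<in> ?L"
    show "j \<in> ?A \<union> ?B"
    proof (cases "j = 1")
      case True
      then show ?thesis using j by (auto simp: add_column_1 split: if_splits)
    next
      case False
      then have "j - 1 \<in> {j \<in> {1..n - 2}. S (n - j - 1, j) = Some Alpha}" "j = Suc (j - 1)"
        using j by (auto simp: add_column_def)
      then show ?thesis by blast
    qed
  next
    fix j assume "j \<in> ?A \<union> ?B"
    then consider k where "j = Suc k" "k \<in> {1..n - 2}" "S (n - k - 1, k) = Some Alpha"
      | "j = 1" "q" "?m = n - 1"
      by (auto split: if_splits)
    then show "j \<in> ?L"
    proof cases
      case 1
      then show ?thesis by (auto simp: add_column_def)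
    next
      case 2
      then have "n - 1 \<in> insert (Suc n) M" using Min_in by metis
      then show ?thesis using 2 m add_column_1[of "n - 1"] by auto
    qed
  qed
  moreover have "?A \<inter> ?B = {}" by auto
  moreover have "card ?A = A3 n S"
    unfolding A3_def by (rule card_image) auto
  moreover have "card ?B = of_bool (q \<and> ?m = n - 1)" by auto
  ultimately show ?thesis
    unfolding A3_def by (simp add: card_Un_disjoint)
qed

section \<open>Recovering a tableau and its first column\<close>

lemma del_column_add_column: "del_column (add_column n S q M) = S"
proof
  fix b :: "nat \<times> nat"
  show "del_column (add_column n S q M) b = S b"
    using tableau_outside[OF S, of "fst b" 0]
    by (cases b) (auto simp: del_column_def add_column_def)
qed

lemma marks_add_column: "{i \<in> {1..n}. add_column n S q M (i, 1) \<noteq> None} = M"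
proof (intro set_eqI)
  fix i
  show "i \<in> {i \<in> {1..n}. add_column n S q M (i, 1) \<noteq> None} \<longleftrightarrow> i \<in> M"
    using M_range[of i] by (auto simp: add_column_1)
qed

lemma coin_add_column: "(\<exists>i. add_column n S q M (i, 1) = Some Alpha) \<longleftrightarrow> q"
proof
  assume "\<exists>i. add_column n S q M (i, 1) = Some Alpha"
  then show q by (auto simp: add_column_1 split: if_splits)
next
  assume q
  then have "add_column n S q M (Min (insert (Suc n) M), 1) = Some Alpha"
    using Min_in unfolding One_nat_def add_column_1 by presburger
  then show "\<exists>i. add_column n S q M (i, 1) = Some Alpha" ..
qed

end

text \<open>Boxes above an \<alpha> are empty, so the first column has at most one \<alpha>, in its
  topmost occupied box. Hence the bit and the marked rows determine the column.\<close>

lemma tableau_cases_column: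
  assumes T: "T \<in> staircase_tableaux (Suc n)"
  defines "q \<equiv> \<exists>i. T (i, 1) = Some Alpha"
    and "M \<equiv> {i \<in> {1..n}. T (i, 1) \<noteq> None}"
  shows "del_column T \<in> staircase_tableaux n"
    and "M \<subseteq> free_rows n (del_column T)"
    and "add_column n (del_column T) q M = T"
proof -
  show "del_column T \<in> staircase_tableaux n"
  proof (rule tableau_intro)
    fix i j :: nat assume "i = 0 \<or> j = 0 \<or> i + j > Suc n"
    then show "del_column T (i, j) = None"
      using tableau_outside[OF T, of i "Suc j"] by (auto simp: del_column_def)
  next
    fix i j i' assume "del_column T (i, j) = Some Alpha" "0 < i'" "i' < i"
    then show "del_column T (i', j) = None"
      using tableau_above_Alpha[OF T] by (auto simp: del_column_def split: if_splits)
  next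
    fix i j j' assume "del_column T (i, j) = Some Beta" "0 < j'" "j' < j"
    then show "del_column T (i, j') = None"
      using tableau_left_of_Beta[OF T, of i "Suc j" "Suc j'"]
      by (auto simp: del_column_def split: if_splits)
  next
    fix i j :: nat assume "1 \<le> i" "1 \<le> j" "i + j = Suc n"
    then show "del_column T (i, j) \<noteq> None"
      using tableau_diagonal[OF T, of i "Suc j"] by (auto simp: del_column_def)
  qed
  show "M \<subseteq> free_rows n (del_column T)"
    using tableau_left_of_Beta[OF T, of _ _ 1]
    by (fastforce simp: M_def free_rows_def del_column_def split: if_splits)
  \<comment> \<open>The box \<open>(Suc n, 1)\<close> lies on the main diagonal and is therefore
    always occupied.\<close>
  have marked: "i \<in> insert (Suc n) M \<longleftrightarrow> T (i, 1) \<noteq> None" for i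
    using tableau_outside[OF T, of i 1] tableau_diagonal[OF T, of "Suc n" 1]
    by (cases "i \<in> {1..n}") (force simp: M_def)+
  have fin: "finite (insert (Suc n) M)" by (simp add: M_def)
  have first_column: "T (i, 1) = Some Alpha \<longleftrightarrow> q \<and> i = Min (insert (Suc n) M)" for i
  proof
    assume a: "T (i, 1) = Some Alpha"
    have "i = Min (insert (Suc n) M)"
    proof (rule Min_eqI[symmetric, OF fin])
      show "i \<in> insert (Suc n) M" using a marked by simp
      show "i \<le> k" if "k \<in> insert (Suc n) M" for k
        using that marked[of k] tableau_above_Alpha[OF T a, of k] by (metis not_le)
    qed
    then show "q \<and> i = Min (insert (Suc n) M)" using a by (auto simp: q_def)
  next
    assume r: "q \<and> i = Min (insert (Suc n) M)"
    then obtain k where k: "T (k, 1) = Some Alpha" by (auto simp: q_def)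
    have "k = Min (insert (Suc n) M)"
    proof (rule Min_eqI[symmetric, OF fin])
      show "k \<in> insert (Suc n) M" using k marked by simp
      show "k \<le> l" if "l \<in> insert (Suc n) M" for l
        using that marked[of l] tableau_above_Alpha[OF T k, of l] by (metis not_le)
    qed
    then show "T (i, 1) = Some Alpha" using r k by simp
  qed
  show "add_column n (del_column T) q M = T"
  proof
    fix b :: "nat \<times> nat"
    obtain i j where b: "b = (i, j)" by fastforce
    show "add_column n (del_column T) q M b = T b"
    proof (cases "j = 1")
      case True
      show ?thesis
        using marked[of i] first_column[of i]
        by (cases "T (i, 1)"; cases "the (T (i, 1))") (auto simp: b True add_column_def)
    next
      case False
      then show ?thesis
        using tableau_outside[OF T, of i 0] by (auto simp: b add_column_def del_column_def)
    qed
  qed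
qed

lemma bij_betw_add_column:
  "bij_betw (\<lambda>(S, q, M). add_column n S q M)
     (SIGMA S:staircase_tableaux n. UNIV \<times> Pow (free_rows n S)) (staircase_tableaux (Suc n))"
proof (rule bij_betw_byWitness[where f' = "\<lambda>T. (del_column T, \<exists>i. T (i, 1) = Some Alpha,
    {i \<in> {1..n}. T (i, 1) \<noteq> None})"])
qed (auto simp: del_column_add_column marks_add_column[simplified] coin_add_column[simplified]
      intro!: add_column_tableau tableau_cases_column[simplified]
      dest: tableau_cases_column(2)[simplified])

section \<open>Generating functions\<close>

text \<open>An arbitrary test function of the free rows is carried along: removing columns leads
  from powers of \<open>card F\<close> to indicators of the last rows, which do not depend on the
  cardinality alone.\<close>

definition tableau_sum ::
    "'a::comm_ring_1 \<Rightarrow> 'a \<Rightarrow> 'a \<Rightarrow> nat \<Rightarrow> (nat set \<Rightarrow> 'a) \<Rightarrow> 'a" where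
  "tableau_sum a b t n \<phi> =
     (\<Sum>S\<in>staircase_tableaux n. a ^ N_alpha n S * b ^ N_beta n S * t ^ A3 n S * \<phi> (free_rows n S))"

text \<open>The transfer operator of one added column. The two summands belong to \<alpha> and
  \<beta> as topmost symbol; only an \<alpha> in row \<open>n - 1\<close> contributes to
  \<open>A3\<close>.\<close>

definition column_sum ::
    "'a::comm_ring_1 \<Rightarrow> 'a \<Rightarrow> 'a \<Rightarrow> nat \<Rightarrow> (nat set \<Rightarrow> 'a) \<Rightarrow> nat set \<Rightarrow> 'a" where
  "column_sum a b t n \<phi> F =
     (\<Sum>M\<in>Pow F. a * b ^ card M * t ^ of_bool (Min (insert (Suc n) M) = n - 1) *
                    \<phi> (insert (Min (insert (Suc n) M)) (F - M))
                + b ^ Suc (card M) * \<phi> (F - M))"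

lemma tableau_sum_0: "tableau_sum a b t 0 \<phi> = \<phi> {}"
proof -
  have "S = (\<lambda>_. None)" if "S \<in> staircase_tableaux 0" for S
  proof
    fix b :: "nat \<times> nat"
    show "S b = None"
      using tableau_outside[OF that, of "fst b" "snd b"] by (cases b) fastforce
  qed
  moreover have "(\<lambda>_. None) \<in> staircase_tableaux 0"
    by (rule tableau_intro) auto
  ultimately have "staircase_tableaux 0 = {\<lambda>_. None}"
    by blast
  moreover have "boxes 0 = {}"
    by (auto simp: boxes_def)
  ultimately show ?thesis
    by (simp add: tableau_sum_def N_alpha_def N_beta_def A3_def free_rows_def)
qed

lemma tableau_sum_Suc:
  "tableau_sum a b t (Suc n) \<phi> = tableau_sum a b t n (column_sum a b t n \<phi>)"
proof -
  define w where "w m S = a ^ N_alpha m S * b ^ N_beta m S * t ^ A3 m S" for m S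
  have "tableau_sum a b t (Suc n) \<phi> =
      (\<Sum>S\<in>staircase_tableaux (Suc n). w (Suc n) S * \<phi> (free_rows (Suc n) S))"
    by (simp add: tableau_sum_def w_def)
  also have "\<dots> = (\<Sum>(S, q, M)\<in>(SIGMA S:staircase_tableaux n. UNIV \<times> Pow (free_rows n S)).
       w (Suc n) (add_column n S q M) * \<phi> (free_rows (Suc n) (add_column n S q M)))"
    by (subst sum.reindex_bij_betw[OF bij_betw_add_column[of n], symmetric])
      (simp add: case_prod_unfold)
  also have "\<dots> = (\<Sum>S\<in>staircase_tableaux n. \<Sum>(q, M)\<in>UNIV \<times> Pow (free_rows n S).
       w (Suc n) (add_column n S q M) * \<phi> (free_rows (Suc n) (add_column n S q M)))"
    by (subst sum.Sigma) (auto simp: finite_staircase_tableaux case_prod_unfold)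
  also have "\<dots> = (\<Sum>S\<in>staircase_tableaux n. w n S * column_sum a b t n \<phi> (free_rows n S))"
  proof (rule sum.cong[OF refl])
    fix S assume S: "S \<in> staircase_tableaux n"
    have "(\<Sum>(q, M)\<in>UNIV \<times> Pow (free_rows n S).
         w (Suc n) (add_column n S q M) * \<phi> (free_rows (Suc n) (add_column n S q M))) =
      (\<Sum>M\<in>Pow (free_rows n S). \<Sum>q\<in>UNIV.
         w (Suc n) (add_column n S q M) * \<phi> (free_rows (Suc n) (add_column n S q M)))"
      by (subst sum.swap) (simp add: sum.cartesian_product)
    also have "\<dots> = w n S * column_sum a b t n \<phi> (free_rows n S)"
      unfolding column_sum_def sum_distrib_left
    proof (rule sum.cong[OF refl])
      fix M assume "M \<in> Pow (free_rows n S)"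
      then have M: "M \<subseteq> free_rows n S" by simp
      show "(\<Sum>q\<in>UNIV. w (Suc n) (add_column n S q M) * \<phi> (free_rows (Suc n) (add_column n S q M))) =
        w n S * (a * b ^ card M * t ^ of_bool (Min (insert (Suc n) M) = n - 1) *
                  \<phi> (insert (Min (insert (Suc n) M)) (free_rows n S - M))
                + b ^ Suc (card M) * \<phi> (free_rows n S - M))"
        by (simp add: UNIV_bool w_def free_rows_add_column[OF S M] N_alpha_add_column[OF S M]
            N_beta_add_column[OF S M] A3_add_column[OF S M] power_add algebra_simps)
    qed
    finally show "(\<Sum>(q, M)\<in>UNIV \<times> Pow (free_rows n S).
         w (Suc n) (add_column n S q M) * \<phi> (free_rows (Suc n) (add_column n S q M))) =
       w n S * column_sum a b t n \<phi> (free_rows n S)" .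
  qed
  finally show ?thesis
    by (simp add: tableau_sum_def w_def)
qed

lemma tableau_sum_cong:
  "(\<And>F. F \<subseteq> {1..n} \<Longrightarrow> \<phi> F = \<psi> F) \<Longrightarrow> tableau_sum a b t n \<phi> = tableau_sum a b t n \<psi>"
  unfolding tableau_sum_def
  by (intro sum.cong refl arg_cong2[where f = "(*)"]) (blast intro: free_rows_subset[THEN subsetD])

lemma tableau_sum_add:
  "tableau_sum a b t n (\<lambda>F. \<phi> F + \<psi> F) = tableau_sum a b t n \<phi> + tableau_sum a b t n \<psi>"
  by (simp add: tableau_sum_def distrib_left sum.distrib)

lemma tableau_sum_mult:
  "tableau_sum a b t n (\<lambda>F. c * \<phi> F) = c * tableau_sum a b t n \<phi>"
  by (simp add: tableau_sum_def sum_distrib_left mult_ac)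

section \<open>Column sums of powers and of last-row indicators\<close>

lemma sum_Pow_powers:
  fixes b x :: "'a::comm_ring_1"
  assumes "finite F"
  shows "(\<Sum>M\<in>Pow F. b ^ card M * x ^ card (F - M)) = (x + b) ^ card F"
  using prod_add[OF assms, of "\<lambda>_. b" "\<lambda>_. x"] by (simp add: add.commute)

lemma Min_insert_Suc_eq_iff:
  assumes "M \<subseteq> {1..n}" "0 < k" "k \<le> n"
  shows "Min (insert (Suc n) M) = k \<longleftrightarrow> k \<in> M \<and> M \<subseteq> {k..n}"
proof -
  have "finite M" using assms(1) finite_subset by blast
  then show ?thesis
    using assms by (subst Min_eq_iff) auto
qed

text \<open>For \<open>t = 1\<close> the binomial theorem gives the first summand. The second
  collects the surplus \<open>t - 1\<close> of the columns with \<alpha> in row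
  \<open>n - 1\<close>, where \<open>M\<close> is \<open>{n - 1}\<close> or
  \<open>{n - 1, n}\<close>.\<close>

lemma column_sum_power:
  assumes F: "F \<subseteq> {1..n}"
  shows "column_sum a b t n (\<lambda>F. x ^ card F) F =
     (a * x + b) * (x + b) ^ card F + (t - 1) * a * b *
       (if n - 1 \<in> F then x ^ card (F - {n}) * (if n \<in> F then x + b else 1) else 0)"
proof -
  have fin: "finite F" using F finite_subset by blast
  \<comment> \<open>The row of the \<alpha> was marked or is the new bottom row, so it is not in
    \<open>F - M\<close> and adds a factor \<open>x\<close>.\<close>
  have card_new: "card (insert (Min (insert (Suc n) M)) (F - M)) = Suc (card (F - M))"
    if "M \<in> Pow F" for M
  proof -
    have "finite M" using that fin finite_subset by auto
    then have "Min (insert (Suc n) M) \<in> insert (Suc n) M" by (metis Min_in finite.insertI insert_not_empty)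
    then have "Min (insert (Suc n) M) \<notin> F - M" using F by auto
    then show ?thesis using fin by simp
  qed
  let ?P = "\<lambda>M. Min (insert (Suc n) M) = n - 1"
  have "column_sum a b t n (\<lambda>F. x ^ card F) F =
      (\<Sum>M\<in>Pow F. (a * x + b) * (b ^ card M * x ^ card (F - M))
          + (t - 1) * a * (if ?P M then b ^ card M * x ^ Suc (card (F - M)) else 0))"
    unfolding column_sum_def by (intro sum.cong refl) (simp add: card_new algebra_simps)
  also have "\<dots> = (a * x + b) * (x + b) ^ card F +
      (t - 1) * a * (\<Sum>M\<in>{M \<in> Pow F. ?P M}. b ^ card M * x ^ Suc (card (F - M)))"
    using fin by (subst sum.inter_filter)
      (simp_all add: sum.distrib sum_distrib_left[symmetric] sum_Pow_powers del: power_Suc)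
  also have "{M \<in> Pow F. ?P M} =
      (if n - 1 \<in> F then (if n \<in> F then {{n - 1}, {n - 1, n}} else {{n - 1}}) else {})"
  proof (cases "n - 1 > 0")
    case True
    have "{M \<in> Pow F. ?P M} = {M \<in> Pow F. n - 1 \<in> M \<and> M \<subseteq> {n - 1, n}}"
    proof (intro Collect_cong conj_cong refl)
      fix M assume "M \<in> Pow F"
      then have "M \<subseteq> {1..n}" using F by auto
      moreover have "{n - 1..n} = {n - 1, n}" by auto
      ultimately show "?P M \<longleftrightarrow> n - 1 \<in> M \<and> M \<subseteq> {n - 1, n}"
        using Min_insert_Suc_eq_iff[of M n "n - 1"] True by simp
    qed
    also have "\<dots> = (if n - 1 \<in> F then (if n \<in> F then {{n - 1}, {n - 1, n}} else {{n - 1}}) else {})"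
    proof -
      have "n - 1 \<in> M \<and> M \<subseteq> {n - 1, n} \<longleftrightarrow> M = {n - 1} \<or> M = {n - 1, n}" for M
        by blast
      then show ?thesis by auto
    qed
    finally show ?thesis .
  next
    case False
    \<comment> \<open>Here \<open>n - 1\<close> is 0, which is not a row, so both sides are
      empty.\<close>
    have "\<not> ?P M" if "M \<in> Pow F" for M
    proof -
      have "finite M" "0 \<notin> insert (Suc n) M" using that fin F finite_subset by auto
      then show ?thesis using False by (metis Min_in finite.insertI insert_not_empty gr0I)
    qed
    moreover have "n - 1 \<notin> F" using False F by auto
    ultimately show ?thesis by auto
  qed
  also have "(\<Sum>M\<in>(if n - 1 \<in> F then (if n \<in> F then {{n - 1}, {n - 1, n}} else {{n - 1}}) else {}).
       b ^ card M * x ^ Suc (card (F - M))) =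
      b * (if n - 1 \<in> F then x ^ card (F - {n}) * (if n \<in> F then x + b else 1) else 0)"
  proof (cases "n - 1 \<in> F")
    case True
    then have n: "n - 1 \<noteq> n" using F by auto
    have *: "card (F - {n - 1}) = card F - 1" "card F \<ge> 1"
      using True fin by (auto simp: Suc_le_eq card_gt_0_iff)
    show ?thesis
    proof (cases "n \<in> F")
      case nF: True
      have "card (F - {n - 1, n}) = card F - 2"
        using True nF n fin by (subst card_Diff_subset) auto
      moreover have "card F \<ge> 2"
        using card_mono[OF fin, of "{n - 1, n}"] True nF n by simp
      then obtain k where "card F = Suc (Suc k)" by (metis Suc_le_D numeral_2_eq_2 Suc_le_mono)
      moreover have "{n - 1} \<noteq> {n - 1, n}" using n by auto
      ultimately show ?thesis using True nF n * by (simp add: algebra_simps)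
    next
      case False
      then have "F - {n} = F" by auto
      moreover obtain k where "card F = Suc k" using * by (metis Suc_le_D One_nat_def)
      ultimately show ?thesis using True False * by simp
    qed
  qed simp
  finally show ?thesis by (simp add: mult.assoc)
qed


text \<open>The new bottom row is free only if its box carries \<alpha>. Being topmost in its
  column, this \<alpha> forces \<open>M = {}\<close>, and a single column survives.\<close>

lemma column_sum_last_row:
  assumes F: "F \<subseteq> {1..n}"
  shows "column_sum a b t n (\<lambda>F. if Suc n \<in> F then \<phi> (F - {Suc n}) else 0) F = a * \<phi> F"
proof -
  have fin: "finite F" using F finite_subset by blast
  have nF: "Suc n \<notin> F" using F by auto
  have "column_sum a b t n (\<lambda>F. if Suc n \<in> F then \<phi> (F - {Suc n}) else 0) F =
      (\<Sum>M\<in>Pow F. if M = {} then a * \<phi> F else 0)"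
    unfolding column_sum_def
  proof (rule sum.cong[OF refl])
    fix M assume M: "M \<in> Pow F"
    have "Min (insert (Suc n) M) \<noteq> Suc n" if "M \<noteq> {}"
    proof -
      have "Min (insert (Suc n) M) \<le> Min M"
        using that M fin by (intro Min_antimono) (auto intro: finite_subset)
      moreover have "Min M \<in> {1..n}" using that M fin F by (metis Min_in PowD finite_subset subsetD)
      ultimately show ?thesis by auto
    qed
    then show "a * b ^ card M * t ^ of_bool (Min (insert (Suc n) M) = n - 1) *
        (if Suc n \<in> insert (Min (insert (Suc n) M)) (F - M)
         then \<phi> (insert (Min (insert (Suc n) M)) (F - M) - {Suc n}) else 0) +
        b ^ Suc (card M) * (if Suc n \<in> F - M then \<phi> (F - M - {Suc n}) else 0) =
        (if M = {} then a * \<phi> F else 0)"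
      using nF by (cases "M = {}") auto
  qed
  then show ?thesis using fin by simp
qed

lemma tableau_sum_last_row:
  "tableau_sum a b t (Suc n) (\<lambda>F. if Suc n \<in> F then \<phi> (F - {Suc n}) else 0)
     = a * tableau_sum a b t n \<phi>"
  unfolding tableau_sum_Suc
  by (subst tableau_sum_cong[OF column_sum_last_row]) (auto simp: tableau_sum_mult)

lemma sum_Pow_insert:
  assumes "finite G" "m \<notin> G"
  shows "(\<Sum>M\<in>Pow (insert m G). f M) = (\<Sum>M\<in>Pow G. f M + f (insert m M))"
proof -
  have "inj_on (insert m) (Pow G)"
    using assms by (intro inj_onI) (metis Pow_iff insert_ident subsetD)
  moreover have "Pow G \<inter> insert m ` Pow G = {}" using assms by auto
  ultimately show ?thesis
    using assms by (simp add: Pow_insert sum.union_disjoint sum.reindex sum.distrib)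
qed

text \<open>The test function is the correction term of \<open>column_sum_power\<close> one size
  higher. Row \<open>m\<close> is free afterwards if it was free and is either unmarked or receives
  the \<alpha>. The \<open>b\<close> in the factor \<open>x + b\<close> for an \<alpha> at the
  bottom, and the column with \<alpha> in row \<open>m\<close>, each give one term
  \<open>a * b\<close>, whence \<open>2 * a * b\<close>.\<close>

lemma column_sum_second_last_row:
  assumes F: "F \<subseteq> {1..m}" and m: "0 < m"
  shows "column_sum a b t m
      (\<lambda>F. if m \<in> F then x ^ card (F - {Suc m}) * (if Suc m \<in> F then x + b else 1) else 0) F =
    (if m \<in> F then x * ((a * x + b) * (x + b) ^ card (F - {m}) + 2 * a * b * x ^ card (F - {m})
       + (t - 1) * a * b * (if m - 1 \<in> F - {m} then x ^ card (F - {m}) else 0)) else 0)"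
    (is "column_sum a b t m ?\<phi> F = _")
proof -
  have fin: "finite F" using F finite_subset by blast
  have Suc_m: "Suc m \<notin> F" using F by auto
  have Min_cases: "Min (insert (Suc m) M) = Suc m \<and> M = {} \<or> Min (insert (Suc m) M) \<in> M \<and> M \<noteq> {}"
    if "M \<subseteq> F" for M
  proof (cases "M = {}")
    case False
    have finM: "finite M" using that fin finite_subset by blast
    have "Min (insert (Suc m) M) \<le> Min M"
      using False finM by (intro Min_antimono) auto
    moreover have "Min M \<in> {1..m}" using False finM that F by (metis Min_in subsetD)
    ultimately have "Min (insert (Suc m) M) \<noteq> Suc m" by auto
    moreover have "Min (insert (Suc m) M) \<in> insert (Suc m) M"
      using finM by (metis Min_in finite.insertI insert_not_empty)
    ultimately show ?thesis using False by blast
  qed simp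
  show ?thesis
  proof (cases "m \<in> F")
    case False
    have "column_sum a b t m ?\<phi> F = (\<Sum>M\<in>Pow F. 0)"
      unfolding column_sum_def
    proof (rule sum.cong[OF refl])
      fix M assume "M \<in> Pow F"
      then have "Min (insert (Suc m) M) \<noteq> m" "m \<notin> F - M" using Min_cases[of M] False by auto
      then show "a * b ^ card M * t ^ of_bool (Min (insert (Suc m) M) = m - 1) *
          ?\<phi> (insert (Min (insert (Suc m) M)) (F - M)) + b ^ Suc (card M) * ?\<phi> (F - M) = 0"
        by auto
    qed
    then show ?thesis using False by simp
  next
    case True
    define G where "G = F - {m}"
    have FG: "F = insert m G" and mG: "m \<notin> G" and finG: "finite G"
      and G: "G \<subseteq> {1..m - 1}"
      using True fin Suc_m F by (auto simp: G_def)
    have card_F: "card F = Suc (card G)" using FG mG finG by simp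
    let ?f = "\<lambda>M. a * b ^ card M * t ^ of_bool (Min (insert (Suc m) M) = m - 1) *
          ?\<phi> (insert (Min (insert (Suc m) M)) (F - M)) + b ^ Suc (card M) * ?\<phi> (F - M)"
    \<comment> \<open>Every \<open>M\<close> avoiding row \<open>m\<close> gives the generic
      binomial term; \<open>M = {}\<close> has in addition the \<open>b\<close> from
      \<open>x + b\<close>, and \<open>M = {m - 1}\<close> the surplus \<open>t - 1\<close>.\<close>
    have unmarked: "?f M = x * ((a * x + b) * (b ^ card M * x ^ card (G - M))) +
        (if M = {} then a * b * x ^ Suc (card G) else 0) +
        (if M = {m - 1} then (t - 1) * a * b * x ^ Suc (card G) else 0)"
      if M: "M \<in> Pow G" for M
    proof -
      have MF: "M \<subseteq> F" using M FG by auto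
      have finM: "finite M" using MF fin finite_subset by blast
      have FM: "F - M = insert m (G - M)" using FG M mG by auto
      have cFM: "card (F - M) = Suc (card (G - M))" unfolding FM using finG mG by simp
      show ?thesis
      proof (cases "M = {}")
        case e: True
        have "insert (Suc m) F - {Suc m} = F" "F - {Suc m} = F" using Suc_m by auto
        then have "?\<phi> (insert (Suc m) F) = x ^ Suc (card G) * (x + b)" "?\<phi> F = x ^ Suc (card G)"
          using True Suc_m card_F by simp_all
        moreover have "?f {} = a * t ^ of_bool (Suc m = m - 1) * ?\<phi> (insert (Suc m) F) + b * ?\<phi> F"
          by (simp only: card.empty power_0 Min_singleton Diff_empty mult_1_right power_Suc)
        moreover have "(Suc m = m - 1) = False" by simp
        ultimately have "?f {} = a * (x ^ Suc (card G) * (x + b)) + b * x ^ Suc (card G)"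
          by (simp only: of_bool_eq power_0 mult_1_right)
        then show ?thesis unfolding e by (simp add: algebra_simps)
      next
        case False
        let ?\<mu> = "Min (insert (Suc m) M)"
        have \<mu>: "?\<mu> \<in> M" using Min_cases[OF MF] False by auto
        have eq: "insert ?\<mu> (F - M) - {Suc m} = insert ?\<mu> (F - M)" "m \<in> insert ?\<mu> (F - M)"
            "Suc m \<notin> insert ?\<mu> (F - M)" "F - M - {Suc m} = F - M" "m \<in> F - M" "Suc m \<notin> F - M"
        proof -
          have "?\<mu> \<noteq> Suc m" using \<mu> MF Suc_m by auto
          then show new: "Suc m \<notin> insert ?\<mu> (F - M)" using Suc_m by (metis Diff_iff insertE)
          show old: "Suc m \<notin> F - M" and mem: "m \<in> F - M" using Suc_m FM by auto
          show "insert ?\<mu> (F - M) - {Suc m} = insert ?\<mu> (F - M)" "F - M - {Suc m} = F - M"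
            using new old by (metis Diff_empty Diff_insert0)+
          show "m \<in> insert ?\<mu> (F - M)" using mem by (rule insertI2)
        qed
        have card_new: "card (insert ?\<mu> (F - M)) = Suc (Suc (card (G - M)))"
          using \<mu> fin cFM by simp
        have iff: "?\<mu> = m - 1 \<longleftrightarrow> M = {m - 1}"
        proof
          assume mu: "?\<mu> = m - 1"
          have "k = m - 1" if "k \<in> M" for k
          proof -
            have "m - 1 \<le> k" using that mu finM Min_le[of "insert (Suc m) M" k] by simp
            moreover have "k \<le> m - 1" using that M G by auto
            ultimately show ?thesis by simp
          qed
          then show "M = {m - 1}" using False by blast
        next
          assume "M = {m - 1}" then show "?\<mu> = m - 1" using \<mu> by simp
        qed
        have f: "?f M = a * b ^ card M * t ^ of_bool (M = {m - 1}) * x ^ Suc (Suc (card (G - M)))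
            + b ^ Suc (card M) * x ^ Suc (card (G - M))"
          unfolding eq(1,4) iff using eq card_new cFM Suc_m by simp
        show ?thesis
        proof (cases "M = {m - 1}")
          case one: True
          then have c: "card G = Suc (card (G - M))" using M finG
            by (metis PowD insert_subset card_Suc_Diff1)
          show ?thesis unfolding f c using one by (auto simp: algebra_simps)
        next
          case False
          then show ?thesis unfolding f using \<open>M \<noteq> {}\<close> by (simp add: algebra_simps)
        qed
      qed
    qed
    \<comment> \<open>A marked row \<open>m\<close> stays free only if it carries the \<alpha>; it
      is then the topmost occupied row, so no row of \<open>G\<close> is marked.\<close>
    have marked: "?f (insert m M) = (if M = {} then a * b * x ^ Suc (card G) else 0)"
      if M: "M \<in> Pow G" for M
    proof -
      have finM: "finite M" using M finG by (metis PowD finite_subset)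
      have FM: "F - insert m M = G - M" using FG M mG by auto
      let ?\<mu> = "Min (insert (Suc m) (insert m M))"
      have iff: "?\<mu> = m \<longleftrightarrow> M = {}"
      proof
        assume mu: "?\<mu> = m"
        have "k \<notin> M" for k
        proof
          assume "k \<in> M"
          then have "m \<le> k" using mu finM Min_le[of "insert (Suc m) (insert m M)" k] by simp
          moreover have "k \<le> m - 1" using \<open>k \<in> M\<close> M G by auto
          ultimately show False using m by simp
        qed
        then show "M = {}" by blast
      qed simp
      show ?thesis
      proof (cases "M = {}")
        case e: True
        have "F - {Suc m} = F" "F - {m} = G" using FG Suc_m mG by auto
        then have "?\<phi> F = x ^ Suc (card G)" "?\<phi> G = 0"
          using True Suc_m mG card_F by simp_all
        moreover have "?f {m} = a * b * t ^ of_bool (m = m - 1) * ?\<phi> F + b ^ 2 * ?\<phi> G"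
        proof -
          have "Min {Suc m, m} = m" "card {m} = 1" "Suc 1 = (2 :: nat)" by simp_all
          then show ?thesis
            using \<open>F - {m} = G\<close> FG by (simp only: power_one_right)
        qed
        moreover have "(m = m - 1) = False" using m by simp
        ultimately have "?f {m} = a * b * x ^ Suc (card G)"
          by (simp only: of_bool_eq power_0 mult_1_right mult_zero_right add_0_right)
        then show ?thesis using e by (simp only: simp_thms if_True)
      next
        case False
        then have "m \<notin> insert ?\<mu> (F - insert m M)" "m \<notin> F - insert m M" using iff FM mG by auto
        then show ?thesis using False by simp
      qed
    qed
    have "column_sum a b t m ?\<phi> F = (\<Sum>M\<in>Pow G. ?f M + ?f (insert m M))"
      unfolding column_sum_def
      by (subst (2) FG) (rule sum_Pow_insert[OF finG mG])
    also have "\<dots> = (\<Sum>M\<in>Pow G. x * (a * x + b) * (b ^ card M * x ^ card (G - M)) +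
        (if M = {} then 2 * a * b * x ^ Suc (card G) else 0) +
        (if M = {m - 1} then (t - 1) * a * b * x ^ Suc (card G) else 0))"
      by (intro sum.cong refl) (simp only: unmarked marked, simp add: algebra_simps)
    also have "\<dots> = x * (a * x + b) * (x + b) ^ card G + 2 * a * b * x ^ Suc (card G) +
        (if m - 1 \<in> G then (t - 1) * a * b * x ^ Suc (card G) else 0)"
      using finG by (simp add: sum.distrib sum_distrib_left[symmetric] sum_Pow_powers
          del: power_Suc)
    finally show ?thesis
      using True by (simp add: G_def[symmetric] algebra_simps)
  qed
qed

section \<open>The generating function in \<open>x\<close> and its closed recursion\<close>

definition tableau_gf :: "'a::comm_ring_1 \<Rightarrow> 'a \<Rightarrow> 'a \<Rightarrow> nat \<Rightarrow> 'a \<Rightarrow> 'a" where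
  "tableau_gf a b t n x = tableau_sum a b t n (\<lambda>F. x ^ card F)"

lemma tableau_gf_0 [simp]: "tableau_gf a b t 0 x = 1"
  by (simp add: tableau_gf_def tableau_sum_0)

lemma tableau_gf_Suc:
  "tableau_gf a b t (Suc n) x = (a * x + b) * tableau_gf a b t n (x + b) + (t - 1) * a * b *
     tableau_sum a b t n
      (\<lambda>F. if n - 1 \<in> F then x ^ card (F - {n}) * (if n \<in> F then x + b else 1) else 0)"
  unfolding tableau_gf_def tableau_sum_Suc tableau_sum_add[symmetric] tableau_sum_mult[symmetric]
  by (intro tableau_sum_cong column_sum_power)

text \<open>Here \<open>n - 1\<close> is 0, never an element of \<open>F\<close>: the third diagonal
  is empty at sizes up to 2.\<close>

lemma tableau_gf_Suc_small:
  assumes "n \<le> 1"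
  shows "tableau_gf a b t (Suc n) x = (a * x + b) * tableau_gf a b t n (x + b)"
proof -
  have "tableau_sum a b t n
      (\<lambda>F. if n - 1 \<in> F then x ^ card (F - {n}) * (if n \<in> F then x + b else 1) else 0) =
      tableau_sum a b t n (\<lambda>F. 0 * 0)"
    using assms by (intro tableau_sum_cong) auto
  then show ?thesis
    unfolding tableau_gf_Suc tableau_sum_mult by simp
qed

lemma tableau_sum_last_row_power:
  "tableau_sum a b t (Suc n) (\<lambda>F. if Suc n \<in> F then x ^ card F else 0)
     = a * x * tableau_gf a b t n x"
proof -
  have "tableau_sum a b t (Suc n) (\<lambda>F. if Suc n \<in> F then x ^ card F else 0) =
      tableau_sum a b t (Suc n) (\<lambda>F. x * (if Suc n \<in> F then x ^ card (F - {Suc n}) else 0))"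
  proof (rule tableau_sum_cong)
    fix F :: "nat set" assume "F \<subseteq> {1..Suc n}"
    then have "finite F" using finite_subset by blast
    then have "x ^ card F = x * x ^ card (F - {Suc n})" if "Suc n \<in> F"
      using card_Suc_Diff1[of F "Suc n"] that by (simp only: power_Suc[symmetric])
    then show "(if Suc n \<in> F then x ^ card F else 0) =
        x * (if Suc n \<in> F then x ^ card (F - {Suc n}) else 0)"
      by (simp only: mult_zero_right split: if_split) blast
  qed
  then show ?thesis
    by (simp only: tableau_sum_mult tableau_sum_last_row[of a b t n "\<lambda>F. x ^ card F"]
        tableau_gf_def mult_ac)
qed

text \<open>The correction in \<open>tableau_gf_Suc\<close> asks for row \<open>k + 1\<close> to be
  free at size \<open>k + 2\<close>. Removing a column turns this into a free bottom row at size
  \<open>k + 1\<close>, and removing another into a factor \<open>a\<close> at size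
  \<open>k\<close>. The remaining indicator of row \<open>k\<close> drops to size
  \<open>k - 1\<close> in the same way.\<close>

lemma tableau_gf_rec:
  "tableau_gf a b t (k + 3) x = (a * x + b) * tableau_gf a b t (k + 2) (x + b) +
     (t - 1) * a\<^sup>2 * b * x * ((a * x + b) * tableau_gf a b t k (x + b)
       + 2 * a * b * tableau_gf a b t k x
       + (if k = 0 then 0 else (t - 1) * a\<^sup>2 * b * x * tableau_gf a b t (k - 1) x))"
proof -
  have "tableau_sum a b t (Suc (Suc k)) (\<lambda>F. if Suc (Suc k) - 1 \<in> F
        then x ^ card (F - {Suc (Suc k)}) * (if Suc (Suc k) \<in> F then x + b else 1) else 0) =
     tableau_sum a b t (Suc k) (\<lambda>F. if Suc k \<in> F then (\<lambda>F. x * ((a * x + b) * (x + b) ^ card F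
       + 2 * a * b * x ^ card F
       + (t - 1) * a * b * (if k \<in> F then x ^ card F else 0))) (F - {Suc k}) else 0)"
    unfolding tableau_sum_Suc[of _ _ _ "Suc k"] diff_Suc_1
    by (intro tableau_sum_cong, subst column_sum_second_last_row) auto
  also have "\<dots> = a * x * ((a * x + b) * tableau_gf a b t k (x + b)
       + 2 * a * b * tableau_gf a b t k x
       + (t - 1) * a * b * tableau_sum a b t k (\<lambda>F. if k \<in> F then x ^ card F else 0))"
    unfolding tableau_sum_last_row[of a b t k "\<lambda>F. x * ((a * x + b) * (x + b) ^ card F
       + 2 * a * b * x ^ card F + (t - 1) * a * b * (if k \<in> F then x ^ card F else 0))"]
      tableau_sum_mult tableau_sum_add tableau_gf_def
    by (simp only: mult.assoc)
  also have "tableau_sum a b t k (\<lambda>F. if k \<in> F then x ^ card F else 0) =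
     (if k = 0 then 0 else a * x * tableau_gf a b t (k - 1) x)"
  proof (cases k)
    case 0
    then show ?thesis by (simp add: tableau_sum_0)
  next
    case (Suc l)
    then show ?thesis by (simp add: tableau_sum_last_row_power)
  qed
  finally show ?thesis
    using tableau_gf_Suc[of a b t "Suc (Suc k)" x]
    by (simp add: numeral_3_eq_3 power2_eq_square mult_ac)
qed

section \<open>The limiting generating function\<close>

lemma norm_exp_minus_1_le:
  fixes z :: complex
  assumes "norm z \<le> 1"
  shows "norm (exp z - 1) \<le> 3 * norm z"
proof -
  have "exp \<bar>Re z\<bar> \<le> exp 1" using assms abs_Re_le_cmod[of z] by simp
  then have "exp \<bar>Re z\<bar> \<le> 3" using exp_le by linarith
  then have "exp \<bar>Re z\<bar> * norm z \<le> 3 * norm z" by (intro mult_right_mono) auto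
  then show ?thesis using Taylor_exp[of z 0] by simp
qed

lemma norm_exp_minus_1_minus_id_le:
  fixes z :: complex
  assumes "norm z \<le> 1"
  shows "norm (exp z - 1 - z) \<le> 3 * (norm z)\<^sup>2"
proof -
  have "exp \<bar>Re z\<bar> \<le> exp 1" using assms abs_Re_le_cmod[of z] by simp
  then have "exp \<bar>Re z\<bar> \<le> 3" using exp_le by linarith
  then have "exp \<bar>Re z\<bar> * (norm z)\<^sup>2 \<le> 3 * (norm z)\<^sup>2" by (intro mult_right_mono) auto
  then show ?thesis using Taylor_exp[of z 1] by (simp add: power2_eq_square diff_diff_eq)
qed

lemma norm_mult_unit_right:
  fixes z w :: complex
  shows "norm z \<le> c \<Longrightarrow> norm w \<le> 1 \<Longrightarrow> norm (z * w) \<le> c"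
  using mult_mono[of "norm z" c "norm w" 1] order_trans[OF norm_ge_zero, of z c]
  by (simp add: norm_mult)

lemma norm_mult_unit_left:
  fixes z w :: complex
  shows "norm z \<le> 1 \<Longrightarrow> norm w \<le> c \<Longrightarrow> norm (z * w) \<le> c"
  using norm_mult_unit_right[of w c z] by (simp add: mult.commute)

section \<open>The approximate solution of the recursion\<close>

locale tableau_pgf =
  fixes \<alpha> \<beta> :: real and t :: complex
  assumes alpha: "\<alpha> > 0" and beta: "\<beta> > 0" and t: "norm t \<le> 1"
begin

abbreviation "\<tau> \<equiv> t - 1"
text \<open>For \<open>x = 1 + j * \<beta>\<close> one has
  \<open>\<alpha> * x + \<beta> = \<alpha> * \<beta> * (j + a + b)\<close>, so after scaling the
  parameters enter only as shifts.\<close>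

abbreviation "a \<equiv> 1 / \<alpha>"
abbreviation "b \<equiv> 1 / \<beta>"

lemma norm_tau: "norm \<tau> \<le> 2"
  using norm_triangle_ineq4[of t 1] t by simp

lemma Re_tau: "Re \<tau> \<le> 0"
  using complex_Re_le_cmod[of t] t by simp

text \<open>The generating function at \<open>t\<close> of the Poisson law with parameter
  \<open>(1 - (s / y)^2) / 2\<close>.\<close>

definition limit_pgf :: "real \<Rightarrow> real \<Rightarrow> complex" where
  "limit_pgf y s = exp (\<tau> / 2 * of_real (1 - (s / y)\<^sup>2))"

lemma exp_scaled:
  assumes "0 \<le> v" "v \<le> 1"
  shows "norm (\<tau> / 2 * of_real v) \<le> v" "norm (exp (\<tau> / 2 * of_real v)) \<le> 1"
proof -
  show "norm (\<tau> / 2 * of_real v) \<le> v"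
    using norm_tau assms mult_right_mono[of "norm \<tau>" 2 v] by (simp add: norm_mult norm_divide)
  have "Re \<tau> * v \<le> 0" using Re_tau assms by (intro mult_nonpos_nonneg) auto
  then show "norm (exp (\<tau> / 2 * of_real v)) \<le> 1"
    using assms by simp
qed

lemma sq_unit: "0 \<le> s \<Longrightarrow> s \<le> y \<Longrightarrow> 0 < y \<Longrightarrow> 0 \<le> (s / y)\<^sup>2 \<and> (s / y)\<^sup>2 \<le> (1::real)"
  by (auto intro!: power_le_one)

lemma norm_limit_pgf:
  assumes "0 \<le> s" "s \<le> y" "0 < y"
  shows "norm (limit_pgf y s) \<le> 1"
  unfolding limit_pgf_def using sq_unit[OF assms] by (intro exp_scaled) auto

text \<open>The exponent has norm at most \<open>1 - (s / y)^2 \<le> 2 * (y - s) / y\<close>. The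
  bound serves small sizes, where \<open>y - s\<close> is bounded.\<close>

lemma limit_pgf_near_1:
  assumes "0 \<le> s" "s \<le> y" "0 < y"
  shows "norm (1 - limit_pgf y s) \<le> 6 * (y - s) / y"
proof -
  let ?v = "1 - (s / y)\<^sup>2"
  have v: "0 \<le> ?v" "?v \<le> 1" using sq_unit[OF assms] by auto
  have "norm (1 - limit_pgf y s) \<le> 3 * norm (\<tau> / 2 * of_real ?v)"
    unfolding limit_pgf_def using exp_scaled(1)[OF v] v
    by (subst norm_minus_commute) (intro norm_exp_minus_1_le, linarith)
  also have "\<dots> \<le> 3 * ?v" using exp_scaled(1)[OF v] by simp
  also have "?v = (1 + s / y) * ((y - s) / y)"
    using assms by (simp add: field_simps power2_eq_square)
  also have "3 * \<dots> \<le> 3 * (2 * ((y - s) / y))"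
    using assms by (intro mult_left_mono mult_right_mono) auto
  finally show ?thesis by simp
qed

lemma limit_pgf_ratio:
  "limit_pgf y s = limit_pgf y' s' * exp (\<tau> / 2 * of_real ((s' / y')\<^sup>2 - (s / y)\<^sup>2))"
  unfolding limit_pgf_def by (simp add: exp_add[symmetric] algebra_simps diff_divide_distrib
      add_divide_distrib)

text \<open>Passing from \<open>s + 1\<close> to \<open>s\<close> adds
  \<open>\<tau> / 2 * (2 * s + 1) / y^2\<close> to the exponent, which to leading order is the
  coefficient of the last term. Replacing \<open>y - 2\<close> by \<open>y\<close> there costs a
  relative error of order \<open>1 / y\<close> against a coefficient of the same order.\<close>

lemma limit_pgf_step:
  assumes s: "0 \<le> s" "s + 1 \<le> y - 2" and y: "y \<ge> 3"
  shows "norm (limit_pgf y s - limit_pgf y (s + 1)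
            - \<tau> * of_real (s / (y * (y - 1))) * limit_pgf (y - 2) (s + 1)) \<le> 39 / y\<^sup>2"
proof -
  define f1 where "f1 = limit_pgf y (s + 1)"
  define f2 where "f2 = limit_pgf (y - 2) (s + 1)"
  define d where "d = ((s + 1) / y)\<^sup>2 - (s / y)\<^sup>2"
  define d' where "d' = ((s + 1) / (y - 2))\<^sup>2 - ((s + 1) / y)\<^sup>2"
  have norm_f1: "norm f1 \<le> 1" unfolding f1_def using s y by (intro norm_limit_pgf) auto
  have norm_f2: "norm f2 \<le> 1" unfolding f2_def using s y by (intro norm_limit_pgf) auto
  have d_eq: "d = (2 * s + 1) / y\<^sup>2"
    unfolding d_def using y by (simp add: field_simps power2_eq_square)
  have d: "0 \<le> d" "d \<le> 2 / y" "d \<le> 1"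
  proof -
    show "0 \<le> d" unfolding d_eq using s by simp
    have "(2 * s + 1) / y\<^sup>2 \<le> 2 * y / y\<^sup>2" using s y by (intro divide_right_mono) auto
    then show "d \<le> 2 / y" unfolding d_eq using y by (simp add: power2_eq_square)
    moreover have "2 / y \<le> 1" using y by simp
    ultimately show "d \<le> 1" by linarith
  qed
  have d': "0 \<le> d'" "d' \<le> 4 / y" "d' \<le> 1"
  proof -
    have "((s + 1) / y)\<^sup>2 \<le> ((s + 1) / (y - 2))\<^sup>2"
      using s y by (intro power_mono divide_left_mono) auto
    then show "0 \<le> d'" unfolding d'_def by simp
    have "d' = ((s + 1) / (y - 2))\<^sup>2 * ((4 * y - 4) / y\<^sup>2)"
    proof -
      have "((s + 1) / y)\<^sup>2 = ((s + 1) / (y - 2))\<^sup>2 * ((y - 2)\<^sup>2 / y\<^sup>2)"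
        using y by (simp add: power_divide)
      moreover have "1 - (y - 2)\<^sup>2 / y\<^sup>2 = (4 * y - 4) / y\<^sup>2"
        using y by (simp add: field_simps power2_eq_square)
      ultimately show ?thesis
        unfolding d'_def by (metis mult.right_neutral right_diff_distrib)
    qed
    also have "\<dots> \<le> 1 * ((4 * y - 4) / y\<^sup>2)"
      using s y by (intro mult_right_mono) (auto intro!: power_le_one)
    also have "\<dots> \<le> 4 * y / y\<^sup>2" using y by (simp add: divide_right_mono)
    finally show "d' \<le> 4 / y" using y by (simp add: power2_eq_square)
    have "((s + 1) / (y - 2))\<^sup>2 \<le> 1" using s y by (auto intro!: power_le_one)
    then show "d' \<le> 1" unfolding d'_def using zero_le_power2[of "(s + 1) / y"] by linarith
  qed
  \<comment> \<open>\<open>?A\<close> is the second-order Taylor remainder, \<open>?B\<close> the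
    surplus 1 in \<open>2 * s + 1\<close>, \<open>?C\<close> the change from \<open>y^2\<close> to
    \<open>y * (y - 1)\<close>, and \<open>?D\<close> the change from \<open>y\<close> to
    \<open>y - 2\<close>. Their bounds 12, 1, 2 and 24 add up to 39.\<close>
  let ?A = "f1 * (exp (\<tau> / 2 * of_real d) - 1 - \<tau> / 2 * of_real d)"
  let ?B = "\<tau> / 2 * of_real (1 / y\<^sup>2) * f1"
  let ?C = "\<tau> * of_real (s / y\<^sup>2 - s / (y * (y - 1))) * f1"
  let ?D = "\<tau> * of_real (s / (y * (y - 1))) * (f2 * (exp (\<tau> / 2 * of_real d') - 1))"
  have f0: "limit_pgf y s = f1 * exp (\<tau> / 2 * of_real d)"
    unfolding f1_def d_def by (rule limit_pgf_ratio)
  have f12: "f1 = f2 * exp (\<tau> / 2 * of_real d')"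
    unfolding f1_def f2_def d'_def by (rule limit_pgf_ratio)
  have D: "?D = \<tau> * of_real (s / (y * (y - 1))) * (f1 - f2)"
    unfolding f12 by (simp add: right_diff_distrib)
  have d_split: "\<tau> / 2 * of_real d = \<tau> * of_real (s / y\<^sup>2) + \<tau> / 2 * of_real (1 / y\<^sup>2)"
    unfolding d_eq by (simp add: add_divide_distrib algebra_simps diff_divide_distrib)
  have split: "limit_pgf y s - f1 - \<tau> * of_real (s / (y * (y - 1))) * f2 = ?A + ?B + ?C + ?D"
  proof -
    define p where "p = \<tau> * of_real (s / (y * (y - 1)))"
    define r where "r = \<tau> * of_real (s / y\<^sup>2)"
    define w where "w = \<tau> / 2 * of_real (1 / y\<^sup>2)"
    have "?C = (r - p) * f1"
      by (simp only: p_def r_def of_real_diff right_diff_distrib)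
    then show ?thesis
      unfolding D f0 by (simp only: p_def[symmetric] w_def[symmetric] d_split[folded r_def w_def])
        (simp add: ring_distribs)
  qed
  have A: "norm ?A \<le> 12 / y\<^sup>2"
  proof -
    have "norm (\<tau> / 2 * of_real d) \<le> d" using d by (intro exp_scaled)
    moreover have "norm (exp (\<tau> / 2 * of_real d) - 1 - \<tau> / 2 * of_real d) \<le> 3 * (norm (\<tau> / 2 * of_real d))\<^sup>2"
      using calculation d by (intro norm_exp_minus_1_minus_id_le) linarith
    moreover have "(norm (\<tau> / 2 * of_real d))\<^sup>2 \<le> (2 / y)\<^sup>2"
      using calculation(1) d by (intro power_mono) (linarith, simp)
    ultimately have "norm (exp (\<tau> / 2 * of_real d) - 1 - \<tau> / 2 * of_real d) \<le> 12 / y\<^sup>2"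
      by (simp add: power_divide)
    then show ?thesis by (rule norm_mult_unit_left[OF norm_f1])
  qed
  have B: "norm ?B \<le> 1 / y\<^sup>2"
  proof -
    have "norm (\<tau> / 2 * of_real (1 / y\<^sup>2)) \<le> 1 / y\<^sup>2"
      using y by (intro exp_scaled) (auto intro: power_le_one simp: field_simps)
    then show ?thesis using norm_f1 by (rule norm_mult_unit_right)
  qed
  have C: "norm ?C \<le> 2 / y\<^sup>2"
  proof -
    have "s / y\<^sup>2 - s / (y * (y - 1)) = - (s / (y - 1) * (1 / y\<^sup>2))"
      using y by (simp add: field_simps power2_eq_square)
    moreover have "s / (y - 1) * (1 / y\<^sup>2) \<le> 1 * (1 / y\<^sup>2)"
      using s y by (intro mult_right_mono) auto
    moreover have "0 \<le> s / (y - 1) * (1 / y\<^sup>2)" using s y by simp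
    ultimately have "\<bar>s / y\<^sup>2 - s / (y * (y - 1))\<bar> \<le> 1 / y\<^sup>2" by linarith
    then have "norm (\<tau> * of_real (s / y\<^sup>2 - s / (y * (y - 1)))) \<le> 2 * (1 / y\<^sup>2)"
      unfolding norm_mult norm_of_real using norm_tau by (intro mult_mono) auto
    also have "2 * (1 / y\<^sup>2) = 2 / y\<^sup>2" by simp
    finally have "norm (\<tau> * of_real (s / y\<^sup>2 - s / (y * (y - 1)))) \<le> 2 / y\<^sup>2" .
    then show ?thesis using norm_f1 by (rule norm_mult_unit_right)
  qed
  have "norm ?D \<le> 24 / y\<^sup>2"
  proof -
    have "s / (y - 1) * (1 / y) \<le> 1 * (1 / y)"
      using s y by (intro mult_right_mono) auto
    then have "\<bar>s / (y * (y - 1))\<bar> \<le> 1 / y" using s y by (simp add: mult.commute)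
    then have 1: "norm (\<tau> * of_real (s / (y * (y - 1)))) \<le> 2 * (1 / y)"
      unfolding norm_mult norm_of_real using norm_tau by (intro mult_mono) auto
    have "norm (\<tau> / 2 * of_real d') \<le> d'" using d' by (intro exp_scaled)
    moreover from this have "norm (exp (\<tau> / 2 * of_real d') - 1) \<le> 3 * norm (\<tau> / 2 * of_real d')"
      using d' by (intro norm_exp_minus_1_le) linarith
    ultimately have "norm (exp (\<tau> / 2 * of_real d') - 1) \<le> 12 / y" using d' by linarith
    then have 2: "norm (f2 * (exp (\<tau> / 2 * of_real d') - 1)) \<le> 12 / y"
      by (rule norm_mult_unit_left[OF norm_f2])
    have "norm ?D \<le> (2 * (1 / y)) * (12 / y)"
      unfolding norm_mult[of "\<tau> * of_real (s / (y * (y - 1)))"] using 1 2 y by (intro mult_mono) auto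
    then show ?thesis by (simp add: power2_eq_square)
  qed
  then have "norm (?A + ?B + ?C + ?D) \<le> 12 / y\<^sup>2 + 1 / y\<^sup>2 + 2 / y\<^sup>2 + 24 / y\<^sup>2"
    by (intro norm_triangle_mono A B C)
  then show ?thesis
    unfolding split[unfolded f1_def f2_def] by (simp add: f1_def f2_def add_divide_distrib[symmetric])
qed

end

section \<open>Convergence of the normalised generating function\<close>

definition partition_fn :: "real \<Rightarrow> real \<Rightarrow> nat \<Rightarrow> real \<Rightarrow> real" where
  "partition_fn \<alpha> \<beta> n x = (\<Prod>i<n. \<alpha> * x + \<beta> + real i * \<alpha> * \<beta>)"

lemma partition_fn_Suc_shift:
  "partition_fn \<alpha> \<beta> (Suc n) x = (\<alpha> * x + \<beta>) * partition_fn \<alpha> \<beta> n (x + \<beta>)"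
  unfolding partition_fn_def prod.lessThan_Suc_shift by (simp add: algebra_simps)

lemma partition_fn_Suc:
  "partition_fn \<alpha> \<beta> (Suc n) x = partition_fn \<alpha> \<beta> n x * (\<alpha> * x + \<beta> + real n * \<alpha> * \<beta>)"
  by (simp add: partition_fn_def)

lemma partition_fn_pos:
  assumes "\<alpha> > 0" "\<beta> > 0" "x \<ge> 0"
  shows "partition_fn \<alpha> \<beta> n x > 0"
  unfolding partition_fn_def using assms
  by (intro prod_pos ballI add_pos_nonneg add_nonneg_pos) auto

text \<open>At \<open>t = 1\<close> the correction in \<open>tableau_gf_Suc\<close> vanishes and
  each column contributes one linear factor; \<open>x\<close> is generalised because it moves to
  \<open>x + \<beta>\<close>.\<close>

lemma tableau_gf_1: "tableau_gf \<alpha> \<beta> 1 n x = partition_fn \<alpha> \<beta> n x"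
  by (induction n arbitrary: x)
    (simp_all add: tableau_gf_Suc partition_fn_Suc_shift, simp add: partition_fn_def)

lemma tableau_gf_of_real:
  "tableau_gf (of_real \<alpha>) (of_real \<beta>) 1 n (of_real x :: complex) = of_real (tableau_gf \<alpha> \<beta> 1 n x)"
  by (simp add: tableau_gf_def tableau_sum_def)

text \<open>Termwise comparison with the nonnegative sum at \<open>t = 1\<close>. It yields the a
  priori bound \<open>norm_G\<close>, which controls the lower-order terms of the recursion.\<close>

lemma norm_tableau_gf_le:
  fixes t :: complex
  assumes "\<alpha> \<ge> 0" "\<beta> \<ge> 0" "norm t \<le> 1" "x \<ge> 0"
  shows "norm (tableau_gf (of_real \<alpha>) (of_real \<beta>) t n (of_real x)) \<le> tableau_gf \<alpha> \<beta> 1 n x"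
  unfolding tableau_gf_def tableau_sum_def
proof (rule sum_norm_le)
  fix S
  have "norm t ^ A3 n S \<le> 1" using assms by (simp add: power_le_one)
  then have "\<alpha> ^ N_alpha n S * \<beta> ^ N_beta n S * norm t ^ A3 n S * x ^ card (free_rows n S) \<le>
      \<alpha> ^ N_alpha n S * \<beta> ^ N_beta n S * 1 * x ^ card (free_rows n S)"
    using assms by (intro mult_right_mono mult_left_mono) auto
  then show "norm (of_real \<alpha> ^ N_alpha n S * of_real \<beta> ^ N_beta n S * t ^ A3 n S *
        of_real x ^ card (free_rows n S)) \<le>
      \<alpha> ^ N_alpha n S * \<beta> ^ N_beta n S * 1 ^ A3 n S * x ^ card (free_rows n S)"
    using assms by (simp add: norm_mult norm_power)
qed

section \<open>The normalised generating function and its error bound\<close>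

context tableau_pgf
begin

text \<open>
  Every step of the recursion \<open>tableau_gf_rec\<close> either keeps \<open>x\<close> or moves it to \<open>x + \<beta>\<close>, so
  starting from \<open>x = 1\<close> only the points \<open>x = 1 + j \<beta>\<close> occur.
\<close>
definition Z :: "nat \<Rightarrow> nat \<Rightarrow> real" where
  "Z n j = partition_fn \<alpha> \<beta> n (1 + real j * \<beta>)"

definition H :: "nat \<Rightarrow> nat \<Rightarrow> complex" where
  "H n j = tableau_gf (of_real \<alpha>) (of_real \<beta>) t n (of_real (1 + real j * \<beta>))"

definition G :: "nat \<Rightarrow> nat \<Rightarrow> complex" where
  "G n j = H n j / of_real (Z n j)"

lemma Z_pos: "Z n j > 0"
  unfolding Z_def using alpha beta by (intro partition_fn_pos) auto

text \<open>Splitting off the last factor keeps \<open>j\<close>; splitting off the first, as in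
  \<open>Z_Suc_shift\<close>, raises it. The recursion has terms of both kinds.\<close>

lemma Z_Suc: "Z (Suc n) j = Z n j * (\<alpha> * \<beta> * (real n + real j + a + b))"
  unfolding Z_def partition_fn_Suc using alpha beta by (simp add: field_simps)

lemma Z_Suc_shift: "Z (Suc n) j = \<alpha> * \<beta> * (real j + a + b) * Z n (Suc j)"
  unfolding Z_def partition_fn_Suc_shift using alpha beta by (simp add: field_simps)

lemma norm_G: "norm (G n j) \<le> 1"
proof -
  have "norm (H n j) \<le> Z n j"
    unfolding H_def Z_def tableau_gf_1[symmetric] using alpha beta t
    by (intro norm_tableau_gf_le) auto
  then show ?thesis
    unfolding G_def using Z_pos[of n j] by (simp add: norm_divide)
qed

lemma H_small: "n \<le> 2 \<Longrightarrow> H n j = of_real (Z n j)"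
proof -
  have 0: "tableau_gf (of_real \<alpha>) (of_real \<beta>) t 0 z = tableau_gf (of_real \<alpha>) (of_real \<beta>) 1 0 z"
    for z :: complex by simp
  have 1: "tableau_gf (of_real \<alpha>) (of_real \<beta>) t (Suc 0) z = tableau_gf (of_real \<alpha>) (of_real \<beta>) 1 (Suc 0) z"
    for z :: complex by (simp add: tableau_gf_Suc_small)
  have 2: "tableau_gf (of_real \<alpha>) (of_real \<beta>) t (Suc (Suc 0)) z =
      tableau_gf (of_real \<alpha>) (of_real \<beta>) 1 (Suc (Suc 0)) z"
    for z :: complex by (simp add: tableau_gf_Suc_small)
  assume "n \<le> 2"
  then consider "n = 0" | "n = Suc 0" | "n = Suc (Suc 0)" by linarith
  then have "H n j = tableau_gf (of_real \<alpha>) (of_real \<beta>) 1 n (of_real (1 + real j * \<beta>))"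
    unfolding H_def using 0 1 2 by cases metis+
  then show ?thesis
    by (simp only: tableau_gf_of_real tableau_gf_1 Z_def)
qed

lemma G_small: "n \<le> 2 \<Longrightarrow> G n j = 1"
  unfolding G_def using H_small Z_pos[of n j] by simp

lemma H_rec:
  "H (k + 3) j = of_real (\<alpha> * \<beta> * (real j + a + b)) * H (k + 2) (Suc j) +
     \<tau> * of_real ((\<alpha> * \<beta>)\<^sup>2 * (real j + b)) *
      (of_real (\<alpha> * \<beta> * (real j + a + b)) * H k (Suc j) + of_real (2 * (\<alpha> * \<beta>)) * H k j
       + (if k = 0 then 0 else \<tau> * of_real ((\<alpha> * \<beta>)\<^sup>2 * (real j + b)) * H (k - 1) j))"
proof -
  let ?x = "of_real (1 + real j * \<beta>) :: complex"
  have 1: "of_real \<alpha> * ?x + of_real \<beta> = (of_real (\<alpha> * \<beta> * (real j + a + b)) :: complex)"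
    unfolding of_real_mult[symmetric] of_real_add[symmetric] of_real_eq_iff
    using alpha beta by (simp add: field_simps)
  have 2: "\<tau> * (of_real \<alpha>)\<^sup>2 * of_real \<beta> * ?x = \<tau> * of_real ((\<alpha> * \<beta>)\<^sup>2 * (real j + b))"
    unfolding mult.assoc[of \<tau>] of_real_mult[symmetric] of_real_power[symmetric]
    using beta by (simp add: field_simps power2_eq_square)
  have 3: "?x + of_real \<beta> = of_real (1 + real (Suc j) * \<beta>)"
    by (simp add: algebra_simps)
  have 4: "2 * of_real \<alpha> * of_real \<beta> = (of_real (2 * (\<alpha> * \<beta>)) :: complex)" by simp
  show ?thesis
    unfolding H_def tableau_gf_rec 1 2 3 4 ..
qed

text \<open>Division by \<open>Z (k + 3) j\<close>, whose last factor is
  \<open>\<alpha> * \<beta> * y\<close>. Since \<open>s \<le> y\<close>, the coefficient of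
  \<open>G k (Suc j)\<close> has order \<open>1 / y\<close> and the last two have order
  \<open>1 / y^2\<close>.\<close>

lemma G_rec:
  fixes k j :: nat
  defines "y \<equiv> real k + real j + 2 + a + b" and "s \<equiv> real j + b"
  shows "G (k + 3) j = G (k + 2) (Suc j) + \<tau> * of_real (s / (y * (y - 1))) * G k (Suc j)
     + \<tau> * of_real (2 * s / (y * (y - 1) * (y - 2))) * G k j
     + (if k = 0 then 0
        else \<tau>\<^sup>2 * of_real (s\<^sup>2 / (y * (y - 1) * (y - 2) * (y - 3))) * G (k - 1) j)"
proof -
  have ab: "a > 0" "b > 0" using alpha beta by auto
  define P where "P = \<alpha> * \<beta>"
  define q where "q = P * (real j + a + b)"
  have P: "P > 0" unfolding P_def using alpha beta by simp
  have "real j + a + b > 0" using ab by linarith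
  then have q: "q > 0" unfolding q_def using P by simp
  have y: "y > 0" "y - 1 > 0" "y - 2 > 0" using ab unfolding y_def by linarith+
  \<comment> \<open>At \<open>k = 0\<close> the factor \<open>y - 3\<close> may vanish or be
    negative, but the term containing it is absent.\<close>
  have y3: "y - 3 > 0" if "k \<noteq> 0"
  proof -
    have "real k \<ge> 1" using that by simp
    then show ?thesis using ab unfolding y_def by linarith
  qed
  have Z1: "Z (k + 3) j = q * Z (k + 2) (Suc j)"
    using Z_Suc_shift[of "k + 2" j] by (simp add: q_def P_def eval_nat_numeral)
  have ys: "real k + real j + a + b = y - 2" "real (Suc k) + real j + a + b = y - 1"
      "real (Suc (Suc k)) + real j + a + b = y" "real k + real (Suc j) + a + b = y - 1"
      "real (Suc k) + real (Suc j) + a + b = y"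
    by (simp_all add: y_def)
  have Z2: "Z (k + 2) (Suc j) = Z k (Suc j) * (P\<^sup>2 * (y * (y - 1)))"
    using Z_Suc[of "Suc k" "Suc j"] Z_Suc[of k "Suc j"] unfolding ys P_def[symmetric]
    by (simp add: power2_eq_square mult_ac)
  have Z3: "Z (k + 3) j = Z k j * (P ^ 3 * (y * (y - 1) * (y - 2)))"
    using Z_Suc[of "Suc (Suc k)" j] Z_Suc[of "Suc k" j] Z_Suc[of k j] unfolding ys P_def[symmetric]
    by (simp add: power3_eq_cube mult_ac numeral_3_eq_3)
  have Z4: "Z k j = Z (k - 1) j * (P * (y - 3))" if "k \<noteq> 0"
    using Z_Suc[of "k - 1" j] that by (simp add: P_def y_def algebra_simps)
  have T1: "of_real q * H (k + 2) (Suc j) / of_real (Z (k + 3) j) = G (k + 2) (Suc j)"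
    unfolding G_def Z1 using q by simp
  have T2: "\<tau> * of_real (P\<^sup>2 * s) * (of_real q * H k (Suc j)) / of_real (Z (k + 3) j) =
      \<tau> * of_real (s / (y * (y - 1))) * G k (Suc j)"
    unfolding G_def Z1 Z2 using q P y Z_pos[of k "Suc j"] by (simp add: power2_eq_square mult_ac)
  have T3: "\<tau> * of_real (P\<^sup>2 * s) * (of_real (2 * P) * H k j) / of_real (Z (k + 3) j) =
      \<tau> * of_real (2 * s / (y * (y - 1) * (y - 2))) * G k j"
    unfolding G_def Z3 using P y Z_pos[of k j] by (simp add: power2_eq_square power3_eq_cube mult_ac)
  have T4: "\<tau> * of_real (P\<^sup>2 * s) * (\<tau> * of_real (P\<^sup>2 * s) * H (k - 1) j) / of_real (Z (k + 3) j) =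
      \<tau>\<^sup>2 * of_real (s\<^sup>2 / (y * (y - 1) * (y - 2) * (y - 3))) * G (k - 1) j" if "k \<noteq> 0"
    unfolding G_def Z3 Z4[OF that] using P y y3[OF that] Z_pos[of "k - 1" j]
    by (simp add: power2_eq_square power3_eq_cube mult_ac)
  have "G (k + 3) j = of_real q * H (k + 2) (Suc j) / of_real (Z (k + 3) j)
     + \<tau> * of_real (P\<^sup>2 * s) * (of_real q * H k (Suc j)) / of_real (Z (k + 3) j)
     + \<tau> * of_real (P\<^sup>2 * s) * (of_real (2 * P) * H k j) / of_real (Z (k + 3) j)
     + (if k = 0 then 0 else
         \<tau> * of_real (P\<^sup>2 * s) * (\<tau> * of_real (P\<^sup>2 * s) * H (k - 1) j) / of_real (Z (k + 3) j))"
    unfolding G_def[of "k + 3"] H_rec P_def[symmetric] q_def[symmetric] s_def[symmetric]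
    by (cases "k = 0") (simp_all only: if_True if_False add_divide_distrib distrib_left add_0_right simp_thms add.assoc)
  then show ?thesis
    unfolding T1 T2 T3 using T4 by (cases "k = 0") simp_all
qed

text \<open>At size 3 all values on the right of the recursion are 1, so the deviation is the sum of
  two coefficients, at most \<open>2 / y + 4 / y\<close>.\<close>

lemma G_3_near_1:
  fixes j :: nat
  defines "y \<equiv> real j + 2 + a + b"
  shows "norm (G 3 j - 1) \<le> 6 / y"
proof -
  have ab: "a > 0" "b > 0" using alpha beta by auto
  define s where "s = real j + b"
  have y: "y > 0" "y - 1 \<ge> 1" "y - 2 > 0" and s: "0 \<le> s" "s \<le> y - 2"
    using ab unfolding y_def s_def by linarith+
  have G3: "G 3 j - 1 = \<tau> * of_real (s / (y * (y - 1))) + \<tau> * of_real (2 * s / (y * (y - 1) * (y - 2)))"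
    using G_rec[of 0 j] by (simp add: G_small y_def s_def)
  have "s / (y - 1) * (1 / y) \<le> 1 * (1 / y)"
    using s y by (intro mult_right_mono) auto
  then have 1: "\<bar>s / (y * (y - 1))\<bar> \<le> 1 / y" using s y by (simp add: mult.commute)
  have "s / (y - 2) * (2 / (y - 1)) * (1 / y) \<le> 1 * 2 * (1 / y)"
    using s y by (intro mult_mono) (auto simp: divide_le_eq)
  then have 2: "\<bar>2 * s / (y * (y - 1) * (y - 2))\<bar> \<le> 2 / y" using s y by (simp add: mult_ac)
  have "norm (\<tau> * of_real (s / (y * (y - 1)))) \<le> 2 * (1 / y)"
    unfolding norm_mult norm_of_real by (intro mult_mono norm_tau 1) auto
  moreover have "norm (\<tau> * of_real (2 * s / (y * (y - 1) * (y - 2)))) \<le> 2 * (2 / y)"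
    unfolding norm_mult norm_of_real by (intro mult_mono norm_tau 2) auto
  ultimately have "norm (G 3 j - 1) \<le> 2 * (1 / y) + 2 * (2 / y)"
    unfolding G3 by (rule norm_triangle_mono)
  then show ?thesis by simp
qed

text \<open>
  With \<open>u = s / y\<close> the error recursion is a discretisation of \<open>- \<phi>' = 2 u \<phi>\<close>, for which
  \<open>\<phi> u = 6/5 - u\<close> is a strict supersolution on the unit interval: \<open>2 u (6/5 - u) \<le> 18/25 < 1\<close>.
  The slack absorbs the residuals of order \<open>1 / y\<^sup>2\<close>.
\<close>
lemma G_error:
  fixes n j :: nat
  assumes "n \<ge> 1"
  defines "y \<equiv> \<lambda>n j. real n + real j - 1 + a + b" and "s \<equiv> \<lambda>j. real j + b"
    and "K \<equiv> 550 + 30 * a"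
  shows "norm (G n j - limit_pgf (y n j) (s j)) \<le> K * (6 / 5 * y n j - s j) / (y n j)\<^sup>2"
  using \<open>n \<ge> 1\<close>
proof (induction n arbitrary: j rule: less_induct)
  case (less n j)
  have ab: "a > 0" "b > 0" using alpha beta by auto
  let ?y = "y n j" and ?s = "s j"
  have y0: "?y > 0" and s0: "0 \<le> ?s" "?s \<le> ?y" and ys: "?y - ?s = real n - 1 + a"
    using less.prems ab unfolding y_def s_def by linarith+
  \<comment> \<open>The summand 550 gives \<open>K / 10 \<ge> 55\<close>, which absorbs the
    residuals of the recursive case; with \<open>30 * a\<close> also
    \<open>K / 5 \<ge> 18 + 6 * a\<close>, as needed for \<open>n \<le> 3\<close>.\<close>
  have K: "K > 0" "K \<ge> 550" using ab unfolding K_def by linarith+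
  \<comment> \<open>Since \<open>s \<le> y\<close>, the target is at least \<open>K / 5 / y\<close>;
    this simpler bound suffices for \<open>n \<le> 3\<close> and for \<open>y < 30\<close>.\<close>
  have crude: "norm (G n j - limit_pgf ?y ?s) \<le> K * (6 / 5 * ?y - ?s) / ?y\<^sup>2"
    if "norm (G n j - limit_pgf ?y ?s) \<le> (K / 5) / ?y"
  proof -
    have "(K / 5) / ?y = K * (1 / 5 * ?y) / ?y\<^sup>2" using y0 by (simp add: power2_eq_square)
    also have "\<dots> \<le> K * (6 / 5 * ?y - ?s) / ?y\<^sup>2"
      using s0 K by (intro divide_right_mono mult_left_mono) auto
    finally show ?thesis using that by linarith
  qed
  show ?case
  proof (cases "n \<le> 3")
    case True
    have G1: "norm (G n j - 1) \<le> 6 / ?y"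
    proof (cases "n = 3")
      case True
      then show ?thesis using G_3_near_1[of j] by (simp add: y_def add_ac)
    next
      case False
      then show ?thesis using G_small[of n j] \<open>n \<le> 3\<close> y0 by simp
    qed
    have "norm (1 - limit_pgf ?y ?s) \<le> 6 * (?y - ?s) / ?y"
      using s0 y0 by (intro limit_pgf_near_1)
    also have "\<dots> \<le> 6 * (2 + a) / ?y"
      unfolding ys using True y0 by (intro divide_right_mono) auto
    finally have "norm (G n j - limit_pgf ?y ?s) \<le> 6 / ?y + 6 * (2 + a) / ?y"
      using G1 norm_triangle_ineq[of "G n j - 1" "1 - limit_pgf ?y ?s"] by simp
    also have "\<dots> = (18 + 6 * a) / ?y" by (simp add: add_divide_distrib[symmetric])
    also have "\<dots> \<le> (K / 5) / ?y"
      using y0 by (intro divide_right_mono) (auto simp: K_def)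
    finally show ?thesis by (rule crude)
  next
    case False
    show ?thesis
    proof (cases "?y < 30")
      case True
      have "norm (G n j - limit_pgf ?y ?s) \<le> 2"
        using norm_triangle_ineq4[of "G n j" "limit_pgf ?y ?s"] norm_G[of n j]
          norm_limit_pgf[OF s0 y0] by linarith
      also have "\<dots> \<le> (K / 5) / ?y" using True y0 K by (simp add: field_simps)
      finally show ?thesis by (rule crude)
    next
      case y30: False
      define k where "k = n - 3"
      have k: "n = k + 3" "k \<ge> 1" using False by (auto simp: k_def)
      define Y where "Y = ?y"
      define u where "u = ?s"
      have Y: "Y \<ge> 30" using y30 by (simp add: Y_def)
      have Yk: "Y = real k + real j + 2 + a + b" by (simp add: Y_def y_def k)
      have u: "0 \<le> u" "u + 1 \<le> Y - 2" using ab k unfolding u_def s_def Yk by linarith+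
      \<comment> \<open>The two neighbours sit at \<open>(Y, u + 1)\<close> and
        \<open>(Y - 2, u + 1)\<close>, exactly the points in \<open>limit_pgf_step\<close>.\<close>
      have "y (k + 2) (Suc j) = Y" "y k (Suc j) = Y - 2" "s (Suc j) = u + 1"
        by (auto simp: Yk y_def u_def s_def)
      then have IH1: "norm (G (k + 2) (Suc j) - limit_pgf Y (u + 1)) \<le> K * (6 / 5 * Y - (u + 1)) / Y\<^sup>2"
        and IH2: "norm (G k (Suc j) - limit_pgf (Y - 2) (u + 1)) \<le>
           K * (6 / 5 * (Y - 2) - (u + 1)) / (Y - 2)\<^sup>2"
        using less.IH[of "k + 2" "Suc j"] less.IH[of k "Suc j"] k by auto
      let ?c2 = "\<tau> * of_real (u / (Y * (Y - 1)))"
      let ?c3 = "\<tau> * of_real (2 * u / (Y * (Y - 1) * (Y - 2)))"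
      let ?c4 = "\<tau>\<^sup>2 * of_real (u\<^sup>2 / (Y * (Y - 1) * (Y - 2) * (Y - 3)))"
      have "G n j = G (k + 2) (Suc j) + ?c2 * G k (Suc j) + ?c3 * G k j + ?c4 * G (k - 1) j"
        using G_rec[of k j] k unfolding u_def s_def Yk by simp
      \<comment> \<open>Subtracting the approximate recursion from the exact one leaves the
        propagated errors, two small terms bounded by \<open>norm_G\<close>, and the
        residual.\<close>
      then have split: "G n j - limit_pgf Y u = (G (k + 2) (Suc j) - limit_pgf Y (u + 1))
          + ?c2 * (G k (Suc j) - limit_pgf (Y - 2) (u + 1)) + ?c3 * G k j + ?c4 * G (k - 1) j
          - (limit_pgf Y u - limit_pgf Y (u + 1) - ?c2 * limit_pgf (Y - 2) (u + 1))"
        by (simp only: right_diff_distrib) simp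
      have frac: "1 / (Y * (Y - 1)) \<le> 2 / Y\<^sup>2"
        using Y by (simp add: field_simps power2_eq_square)
      have n2: "norm (?c2 * (G k (Suc j) - limit_pgf (Y - 2) (u + 1))) \<le> 9 / 10 * K / Y\<^sup>2"
      proof -
        have "norm ?c2 \<le> 2 * (u / (Y * (Y - 1)))"
          unfolding norm_mult norm_of_real using norm_tau u Y by (intro mult_mono) auto
        then have "norm (?c2 * (G k (Suc j) - limit_pgf (Y - 2) (u + 1))) \<le>
            2 * (u / (Y * (Y - 1))) * (K * (6 / 5 * (Y - 2) - (u + 1)) / (Y - 2)\<^sup>2)"
          unfolding norm_mult[of ?c2] using IH2 u Y by (intro mult_mono) auto
        also have "\<dots> = 2 * K / (Y * ((Y - 1) * (Y - 2)\<^sup>2)) * (u * (6 / 5 * (Y - 2) - (u + 1)))"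
          by (simp add: mult_ac)
        also have "\<dots> \<le> 2 * K / (Y * ((Y - 1) * (Y - 2)\<^sup>2)) * (9 / 25 * Y\<^sup>2)"
        proof (intro mult_left_mono)
          have "6 / 5 * (Y - 2) - (u + 1) \<le> 6 / 5 * Y - u"
            by (simp add: right_diff_distrib)
          then have "u * (6 / 5 * (Y - 2) - (u + 1)) \<le> u * (6 / 5 * Y - u)"
            using u(1) by (rule mult_left_mono)
          \<comment> \<open>Completing the square: the maximum over \<open>u\<close> is attained at
            \<open>u = 3 / 5 * Y\<close>.\<close>
          also have "\<dots> = 9 / 25 * Y\<^sup>2 - (3 / 5 * Y - u)\<^sup>2"
            by (simp add: power2_eq_square algebra_simps)
          also have "\<dots> \<le> 9 / 25 * Y\<^sup>2" by simp
          finally show "u * (6 / 5 * (Y - 2) - (u + 1)) \<le> 9 / 25 * Y\<^sup>2" .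
        qed (use K Y in auto)
        also have "\<dots> = K / Y\<^sup>2 * (18 / 25 * Y ^ 3 / ((Y - 1) * (Y - 2)\<^sup>2))"
        proof -
          have "2 * K / (Y * W) * (9 / 25 * Y\<^sup>2) = K / Y\<^sup>2 * (18 / 25 * Y ^ 3 / W)" if "W > 0" for W
            using Y that by (simp add: field_simps power2_eq_square power3_eq_cube)
          then show ?thesis using Y by simp
        qed
        also have "\<dots> \<le> K / Y\<^sup>2 * (9 / 10)"
        proof (intro mult_left_mono)
          \<comment> \<open>The bracket with \<open>9 / 50\<close> is nonnegative from
            \<open>Y = 25\<close> on, which the threshold 30 ensures; raising 18/25 to 9/10 pays for
            the shifted denominators.\<close>
          have "18 / 25 * Y ^ 3 + Y\<^sup>2 * (9 / 50 * Y - 9 / 2) + (36 / 5 * Y - 18 / 5) =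
              9 / 10 * ((Y - 1) * (Y - 2)\<^sup>2)"
            by (simp add: power2_eq_square power3_eq_cube algebra_simps)
          moreover have "Y\<^sup>2 * (9 / 50 * Y - 9 / 2) \<ge> 0" using Y by (intro mult_nonneg_nonneg) auto
          ultimately have "18 / 25 * Y ^ 3 \<le> 9 / 10 * ((Y - 1) * (Y - 2)\<^sup>2)" using Y by linarith
          then show "18 / 25 * Y ^ 3 / ((Y - 1) * (Y - 2)\<^sup>2) \<le> 9 / 10"
            using Y by (subst divide_le_eq) auto
        qed (use K in auto)
        finally show ?thesis by simp
      qed
      have n3: "norm (?c3 * G k j) \<le> 8 / Y\<^sup>2"
      proof -
        have "2 * u / (Y * (Y - 1) * (Y - 2)) = u / (Y - 2) * (2 * (1 / (Y * (Y - 1))))"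
          by (simp add: mult_ac)
        also have "\<dots> \<le> 1 * (2 * (2 / Y\<^sup>2))"
          using u Y frac by (intro mult_mono) auto
        finally have "norm ?c3 \<le> 2 * (4 / Y\<^sup>2)"
          unfolding norm_mult norm_of_real using norm_tau u Y by (intro mult_mono) auto
        also have "2 * (4 / Y\<^sup>2) = 8 / Y\<^sup>2" by simp
        finally have "norm ?c3 \<le> 8 / Y\<^sup>2" .
        then show ?thesis using norm_G[of k j] by (rule norm_mult_unit_right)
      qed
      have n4: "norm (?c4 * G (k - 1) j) \<le> 8 / Y\<^sup>2"
      proof -
        have "u\<^sup>2 / (Y * (Y - 1) * (Y - 2) * (Y - 3)) = u / (Y - 2) * (u / (Y - 3)) * (1 / (Y * (Y - 1)))"
          by (simp add: power2_eq_square mult_ac)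
        also have "\<dots> \<le> 1 * 1 * (2 / Y\<^sup>2)"
          using u Y frac by (intro mult_mono) auto
        finally have "\<bar>u\<^sup>2 / (Y * (Y - 1) * (Y - 2) * (Y - 3))\<bar> \<le> 2 / Y\<^sup>2"
          using u Y by simp
        moreover have "norm \<tau> ^ 2 \<le> 2\<^sup>2" using norm_tau by (intro power_mono) auto
        ultimately have "norm ?c4 \<le> 2\<^sup>2 * (2 / Y\<^sup>2)"
          unfolding norm_mult norm_of_real norm_power by (intro mult_mono) auto
        also have "2\<^sup>2 * (2 / Y\<^sup>2) = 8 / Y\<^sup>2" by simp
        finally have "norm ?c4 \<le> 8 / Y\<^sup>2" .
        then show ?thesis using norm_G[of "k - 1" j] by (rule norm_mult_unit_right)
      qed
      have n5: "norm (limit_pgf Y u - limit_pgf Y (u + 1) - ?c2 * limit_pgf (Y - 2) (u + 1)) \<le> 39 / Y\<^sup>2"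
        using u Y by (intro limit_pgf_step) auto
      have "norm (G n j - limit_pgf Y u) \<le>
          K * (6 / 5 * Y - (u + 1)) / Y\<^sup>2 + 9 / 10 * K / Y\<^sup>2 + 8 / Y\<^sup>2 + 8 / Y\<^sup>2 + 39 / Y\<^sup>2"
        unfolding split
        by (intro order_trans[OF norm_triangle_ineq4] add_mono n5 norm_triangle_mono IH1 n2 n3 n4)
      \<comment> \<open>The shift from \<open>u\<close> to \<open>u + 1\<close> gains
        \<open>K\<close>, the propagated error costs \<open>9 / 10 * K\<close>, and the remaining
        \<open>K / 10\<close> covers 8 + 8 + 39 = 55.\<close>
      also have "\<dots> = (K * (6 / 5 * Y - u) - K / 10 + 55) / Y\<^sup>2"
        unfolding add_divide_distrib[symmetric]
        by (rule arg_cong[where f = "\<lambda>z. z / Y\<^sup>2"]) (simp add: algebra_simps)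
      also have "\<dots> \<le> K * (6 / 5 * Y - u) / Y\<^sup>2"
        using K by (intro divide_right_mono) auto
      finally show ?thesis by (simp add: Y_def u_def)
    qed
  qed
qed

text \<open>At \<open>j = 0\<close> the value \<open>s = b\<close> is fixed while \<open>y\<close>
  tends to infinity, so \<open>s / y\<close> tends to 0 and the error bound is of order
  \<open>1 / y\<close>.\<close>

lemma G_tendsto: "(\<lambda>n. G n 0) \<longlonglongrightarrow> exp (\<tau> / 2)"
proof -
  let ?y = "\<lambda>n::nat. real n + real 0 - 1 + a + b"
  have ylim: "filterlim ?y at_top sequentially"
    by (simp add: add_ac) real_asymp
  have "(\<lambda>n. limit_pgf (?y n) b) \<longlonglongrightarrow> exp (\<tau> / 2 * of_real (1 - 0\<^sup>2))"
    unfolding limit_pgf_def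
    by (intro tendsto_intros tendsto_divide_0[OF tendsto_const]
        filterlim_mono[OF ylim at_top_le_at_infinity order_refl])
  moreover have "(\<lambda>n. G n 0 - limit_pgf (?y n) b) \<longlonglongrightarrow> 0"
  proof (rule Lim_null_comparison)
    show "\<forall>\<^sub>F n in sequentially. norm (G n 0 - limit_pgf (?y n) b) \<le>
        (550 + 30 * a) * (6 / 5 * ?y n - b) / (?y n)\<^sup>2"
      using eventually_ge_at_top[of 1] by eventually_elim (use G_error[of _ 0] in simp)
    show "(\<lambda>n. (550 + 30 * a) * (6 / 5 * ?y n - b) / (?y n)\<^sup>2) \<longlonglongrightarrow> 0"
      by real_asymp
  qed
  ultimately have "(\<lambda>n. (G n 0 - limit_pgf (?y n) b) + limit_pgf (?y n) b) \<longlonglongrightarrow> 0 + exp (\<tau> / 2 * of_real (1 - 0\<^sup>2))"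
    by (intro tendsto_add)
  then show ?thesis by simp
qed

end

section \<open>Convergence in distribution\<close>

lemma sum_wt: "(\<Sum>S\<in>staircase_tableaux n. wt \<alpha> \<beta> n S) = partition_fn \<alpha> \<beta> n 1"
  unfolding tableau_gf_1[symmetric] tableau_gf_def tableau_sum_def wt_def by simp

lemma pmf_tableau_law:
  assumes "\<alpha> > 0" "\<beta> > 0"
  shows "pmf (tableau_law \<alpha> \<beta> n) S =
    (if S \<in> staircase_tableaux n then wt \<alpha> \<beta> n S / partition_fn \<alpha> \<beta> n 1 else 0)"
proof -
  let ?f = "\<lambda>S. if S \<in> staircase_tableaux n then wt \<alpha> \<beta> n S / partition_fn \<alpha> \<beta> n 1 else 0"
  have Z: "partition_fn \<alpha> \<beta> n 1 > 0" using assms by (intro partition_fn_pos) auto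
  have nonneg: "0 \<le> ?f S" for S using assms Z by (simp add: wt_def)
  have "(\<integral>\<^sup>+S. ennreal (?f S) \<partial>count_space UNIV) = (\<Sum>S\<in>staircase_tableaux n. ennreal (?f S))"
    by (rule nn_integral_count_space'[OF finite_staircase_tableaux]) auto
  also have "\<dots> = ennreal (\<Sum>S\<in>staircase_tableaux n. ?f S)"
    using nonneg by (rule sum_ennreal)
  also have "(\<Sum>S\<in>staircase_tableaux n. ?f S) = 1"
    using Z by (simp add: sum_divide_distrib[symmetric] sum_wt)
  finally have "(\<integral>\<^sup>+S. ennreal (?f S) \<partial>count_space UNIV) = 1" by simp
  then show ?thesis
    unfolding tableau_law_def sum_wt by (intro pmf_embed_pmf nonneg)
qed

section \<open>Characteristic functions\<close>

lemma char_distr_pmf: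
  "char (distr (measure_pmf p) borel f) \<theta> = (CLINT x|measure_pmf p. iexp (\<theta> * f x))"
  unfolding char_def by (subst integral_distr) auto

text \<open>The expectation of \<open>iexp (\<theta> * A3)\<close> is the weighted sum at
  \<open>t = iexp \<theta>\<close> over the normalising constant; \<open>j = 0\<close> means
  \<open>x = 1\<close>, so free rows are not weighted.\<close>

lemma char_tableau_law:
  assumes "\<alpha> > 0" "\<beta> > 0"
  shows "char (distr (measure_pmf (tableau_law \<alpha> \<beta> n)) borel (\<lambda>S. real (A3 n S))) \<theta> =
    tableau_pgf.G \<alpha> \<beta> (iexp \<theta>) n 0"
proof -
  interpret tableau_pgf \<alpha> \<beta> "iexp \<theta>" by standard (use assms in auto)
  have "char (distr (measure_pmf (tableau_law \<alpha> \<beta> n)) borel (\<lambda>S. real (A3 n S))) \<theta> =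
      (\<Sum>S\<in>staircase_tableaux n. pmf (tableau_law \<alpha> \<beta> n) S *\<^sub>R iexp (\<theta> * real (A3 n S)))"
    unfolding char_distr_pmf using finite_staircase_tableaux
    by (rule integral_measure_pmf)
      (auto simp: set_pmf_iff pmf_tableau_law[OF assms] split: if_splits)
  also have "\<dots> = (\<Sum>S\<in>staircase_tableaux n. of_real \<alpha> ^ N_alpha n S * of_real \<beta> ^ N_beta n S *
      iexp \<theta> ^ A3 n S) / of_real (Z n 0)"
    unfolding sum_divide_distrib
    by (intro sum.cong refl) (simp add: pmf_tableau_law[OF assms] Z_def scaleR_conv_of_real wt_def
        exp_of_nat_mult[symmetric] mult_ac)
  also have "\<dots> = G n 0"
    unfolding G_def H_def tableau_gf_def tableau_sum_def by simp
  finally show ?thesis .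
qed

lemma char_poisson:
  assumes "r > 0"
  shows "char (distr (measure_pmf (poisson_pmf r)) borel real) \<theta> = exp (of_real r * (iexp \<theta> - 1))"
proof -
  let ?f = "\<lambda>k. pmf (poisson_pmf r) k *\<^sub>R iexp (\<theta> * real k)"
  have "(\<lambda>k. (of_real r * iexp \<theta>) ^ k /\<^sub>R fact k) sums exp (of_real r * iexp \<theta>)"
    by (rule exp_converges)
  then have "(\<lambda>k. of_real (exp (- r)) * ((of_real r * iexp \<theta>) ^ k /\<^sub>R fact k)) sums
      (of_real (exp (- r)) * exp (of_real r * iexp \<theta>))"
    by (rule sums_mult)
  also have "(\<lambda>k. of_real (exp (- r)) * ((of_real r * iexp \<theta>) ^ k /\<^sub>R fact k)) = ?f"
    using assms by (simp add: fun_eq_iff scaleR_conv_of_real power_mult_distrib exp_of_nat_mult[symmetric]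
        field_simps)
  also have "of_real (exp (- r)) * exp (of_real r * iexp \<theta>) = exp (of_real r * (iexp \<theta> - 1))"
    by (simp add: exp_of_real[symmetric] exp_add[symmetric] algebra_simps)
  finally have sums: "?f sums exp (of_real r * (iexp \<theta> - 1))" .
  have "(CLINT k|measure_pmf (poisson_pmf r). iexp (\<theta> * real k)) = (CLINT k|count_space UNIV. ?f k)"
    unfolding measure_pmf_eq_density by (rule integral_density) auto
  \<comment> \<open>As \<open>iexp\<close> has norm 1, the terms are dominated by the point masses;
    this turns the integral into the exponential series.\<close>
  moreover have "integrable (count_space UNIV) ?f"
    by (rule Bochner_Integration.integrable_bound[OF integrable_pmf[of UNIV "poisson_pmf r"]]) auto
  ultimately show ?thesis
    unfolding char_distr_pmf using integral_count_space_nat[of ?f] sums_unique[OF sums] by metis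
qed

text \<open>
  The measure of a pmf carries the discrete sigma-algebra, so Levy continuity only applies to the
  push-forwards to \<^const>\<open>borel\<close>.
\<close>
lemma cdf_map_pmf: "cdf (measure_pmf (map_pmf f p)) = cdf (distr (measure_pmf p) borel f)"
  by (auto simp: fun_eq_iff cdf_def measure_distr)

theorem theorem4p3:
  fixes \<alpha> \<beta> :: real
  assumes "\<alpha> > 0" and "\<beta> > 0"
  shows "weak_conv_m
           (\<lambda>m. measure_pmf (map_pmf (\<lambda>S. real (A3 (m + 3) S)) (tableau_law \<alpha> \<beta> (m + 3))))
           (measure_pmf (map_pmf real (poisson_pmf (1/2))))"
proof -
  have "weak_conv_m
     (\<lambda>m. distr (measure_pmf (tableau_law \<alpha> \<beta> (m + 3))) borel (\<lambda>S. real (A3 (m + 3) S)))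
     (distr (measure_pmf (poisson_pmf (1/2))) borel real)"
  proof (rule levy_continuity)
    fix \<theta> :: real
    interpret tableau_pgf \<alpha> \<beta> "iexp \<theta>" by standard (use assms in auto)
    show "(\<lambda>m. char (distr (measure_pmf (tableau_law \<alpha> \<beta> (m + 3))) borel
            (\<lambda>S. real (A3 (m + 3) S))) \<theta>)
        \<longlonglongrightarrow> char (distr (measure_pmf (poisson_pmf (1/2))) borel real) \<theta>"
      \<comment> \<open>The limit \<open>exp ((iexp \<theta> - 1) / 2)\<close> is the Poisson
        characteristic function, and starting at size 3 does not change it.\<close>
      using LIMSEQ_ignore_initial_segment[OF G_tendsto, of 3]
      by (simp add: char_tableau_law[OF assms] char_poisson)
  qed (auto intro!: prob_space.real_distribution_distr measure_pmf.prob_space_axioms)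
  then show ?thesis
    by (simp add: weak_conv_m_def cdf_map_pmf)
qed

end
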